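(* Let $\mathfrak{A}$ be any model of Presburger Arithmetic $\mathbf{PrA}$ that is interpreted (possibly multi-dimensionally, i.e. by an $m$-dimensional interpretation for some $m\ge 1$) in the model $(\mathbb{N},+)$. Then: (a) $\mathfrak{A}$ is isomorphic to $(\mathbb{N},+)$; (b) the isomorphism between $\mathfrak{A}$ and $(\mathbb{N},+)$ is definable in $(\mathbb{N},+)$.
   Context: $\mathbb{N}$ includes $0$. Presburger Arithmetic $\mathbf{PrA}$ is the elementary (first-order) theory of the model $(\mathbb{N},+)$, i.e. the set of all first-order sentences true in $(\mathbb{N},+)$. An $m$-dimensional interpretation $\iota$ ($m\ge 1$) of a first-order language $\mathcal{K}$ in a model $\mathfrak{M}$ consists of (parameter-free) first-order formulas of the language of $\mathfrak{M}$: $D_\iota(\overline{y})$ defining a set $\mathbf{D}_\iota\subseteq\mathfrak{M}^m$ (the domain); $P_\iota(\overline{x}_1,\ldots,\overline{x}_n)$ for each predicate symbol $P(x_1,\ldots,x_n)$ of $\mathcal{K}$, including equality; $f_\iota(\overline{x}_1,\ldots,\overline{x}_n,\overline{y})$ for each function symbol $f(x_1,\ldots,x_n)$ of $\mathcal{K}$. All vectors of variables have length $m$, and each $f_\iota$ defines the graph of a function modulo the interpretation of equality. This yields a $\mathcal{K}$-structure (the internal model) with domain $\mathbf{D}_\iota/{\sim_\iota}$, where $\sim_\iota$ is the equivalence relation given by the formula $=_\iota(\overline{x}_1,\overline{x}_2)$. A model is interpreted in $\mathfrak{M}$ if it is the internal model of an $m$-dimensional interpretation in $\mathfrak{M}$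 for some $m\ge 1$. The isomorphism being definable means that there is a first-order formula $F(\overline{x},y)$ of the language of $(\mathbb{N},+)$ (with $\overline{x}$ of length $m$) which defines an isomorphism from the internal model $\mathfrak{A}$ (elements represented by tuples in $\mathbf{D}_\iota$) to $(\mathbb{N},+)$. *)

theory Defs
  imports Main
begin

section \<open>First-order logic over the language of \<open>(\<nat>, +)\<close>\<close>

datatype trm = Var nat | Plus trm trm

text \<open>Variables are named by natural numbers; the remaining connectives are definable.\<close>

datatype fm = Eq trm trm | Neg fm | Conj fm fm | Ex nat fm

primrec fv_trm :: "trm \<Rightarrow> nat set" where
  "fv_trm (Var i) = {i}"
| "fv_trm (Plus s t) = fv_trm s \<union> fv_trm t"

primrec fv :: "fm \<Rightarrow> nat set" where
  "fv (Eq s t) = fv_trm s \<union> fv_trm t"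
| "fv (Neg \<phi>) = fv \<phi>"
| "fv (Conj \<phi> \<psi>) = fv \<phi> \<union> fv \<psi>"
| "fv (Ex i \<phi>) = fv \<phi> - {i}"

record 'a struct =
  universe :: "'a set"
  addition :: "'a \<Rightarrow> 'a \<Rightarrow> 'a"

definition fo_struct :: "'a struct \<Rightarrow> bool" where
  "fo_struct M \<longleftrightarrow> universe M \<noteq> {} \<and>
     (\<forall>x\<in>universe M. \<forall>y\<in>universe M. addition M x y \<in> universe M)"

primrec val :: "'a struct \<Rightarrow> (nat \<Rightarrow> 'a) \<Rightarrow> trm \<Rightarrow> 'a" where
  "val M e (Var i) = e i"
| "val M e (Plus s t) = addition M (val M e s) (val M e t)"

primrec sat :: "'a struct \<Rightarrow> (nat \<Rightarrow> 'a) \<Rightarrow> fm \<Rightarrow> bool" where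
  "sat M e (Eq s t) \<longleftrightarrow> val M e s = val M e t"
| "sat M e (Neg \<phi>) \<longleftrightarrow> \<not> sat M e \<phi>"
| "sat M e (Conj \<phi> \<psi>) \<longleftrightarrow> sat M e \<phi> \<and> sat M e \<psi>"
| "sat M e (Ex i \<phi>) \<longleftrightarrow> (\<exists>a\<in>universe M. sat M (e(i := a)) \<phi>)"

definition true_in :: "'a struct \<Rightarrow> fm \<Rightarrow> bool" where
  "true_in M \<phi> \<longleftrightarrow> (\<forall>e. (\<forall>i. e i \<in> universe M) \<longrightarrow> sat M e \<phi>)"

definition model_of :: "'a struct \<Rightarrow> fm set \<Rightarrow> bool" where
  "model_of M T \<longleftrightarrow> fo_struct M \<and> (\<forall>\<phi>\<in>T. true_in M \<phi>)"

definition nat_plus :: "nat struct" where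
  "nat_plus = \<lparr>universe = UNIV, addition = (+)\<rparr>"

definition PrA :: "fm set" where
  "PrA = {\<phi>. fv \<phi> = {} \<and> true_in nat_plus \<phi>}"

definition isomorphism :: "'a struct \<Rightarrow> 'b struct \<Rightarrow> ('a \<Rightarrow> 'b) \<Rightarrow> bool" where
  "isomorphism M N h \<longleftrightarrow> bij_betw h (universe M) (universe N) \<and>
     (\<forall>x\<in>universe M. \<forall>y\<in>universe M. h (addition M x y) = addition N (h x) (h y))"

definition isomorphic :: "'a struct \<Rightarrow> 'b struct \<Rightarrow> bool" where
  "isomorphic M N \<longleftrightarrow> (\<exists>h. isomorphism M N h)"

text \<open>
  \<open>k\<close>-tuples are lists of length \<open>k\<close>, the \<open>i\<close>-th component being the value of variable \<open>i\<close>.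
  This is only meaningful when \<open>fv \<phi> \<subseteq> {..<k}\<close>, as \<open>xs ! i\<close> is unspecified for \<open>i \<ge> k\<close>;
  the definitions below impose this wherever a formula is used.
\<close>

definition def_set :: "'a struct \<Rightarrow> nat \<Rightarrow> fm \<Rightarrow> 'a list set" where
  "def_set M k \<phi> = {xs. length xs = k \<and> set xs \<subseteq> universe M \<and> sat M (\<lambda>i. xs ! i) \<phi>}"


section \<open>Multi-dimensional interpretations of the language of \<open>(\<nat>, +)\<close>\<close>

record interp =
  dim :: nat
  dom_fm :: fm
  eq_fm :: fm
  add_fm :: fm

definition idom :: "'a struct \<Rightarrow> interp \<Rightarrow> 'a list set" where
  "idom M \<iota> = def_set M (dim \<iota>) (dom_fm \<iota>)"

definition ieq :: "'a struct \<Rightarrow> interp \<Rightarrow> ('a list \<times> 'a list) set" where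
  "ieq M \<iota> = {(x, y). x \<in> idom M \<iota> \<and> y \<in> idom M \<iota> \<and>
     x @ y \<in> def_set M (2 * dim \<iota>) (eq_fm \<iota>)}"

text \<open>
  The relation that \<open>add_fm\<close> induces on equivalence classes. If \<open>add_fm\<close> is compatible with
  \<open>ieq\<close>, the choice of representatives is immaterial; compatibility is not required, so this
  is the most permissive reading of a formula defining a graph modulo \<open>ieq\<close>.
\<close>

definition iadd :: "'a struct \<Rightarrow> interp \<Rightarrow> 'a list set \<Rightarrow> 'a list set \<Rightarrow> 'a list set \<Rightarrow> bool" where
  "iadd M \<iota> X Y Z \<longleftrightarrow>
     (\<exists>x\<in>X. \<exists>y\<in>Y. \<exists>z\<in>Z. x @ y @ z \<in> def_set M (3 * dim \<iota>) (add_fm \<iota>))"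

definition interpretation_in :: "'a struct \<Rightarrow> interp \<Rightarrow> bool" where
  "interpretation_in M \<iota> \<longleftrightarrow>
     dim \<iota> \<ge> 1 \<and>
     fv (dom_fm \<iota>) \<subseteq> {..<dim \<iota>} \<and>
     fv (eq_fm \<iota>) \<subseteq> {..<2 * dim \<iota>} \<and>
     fv (add_fm \<iota>) \<subseteq> {..<3 * dim \<iota>} \<and>
     idom M \<iota> \<noteq> {} \<and>
     equiv (idom M \<iota>) (ieq M \<iota>) \<and>
     (\<forall>X \<in> idom M \<iota> // ieq M \<iota>. \<forall>Y \<in> idom M \<iota> // ieq M \<iota>.
        \<exists>!Z. Z \<in> idom M \<iota> // ieq M \<iota> \<and> iadd M \<iota> X Y Z)"

definition internal_model :: "'a struct \<Rightarrow> interp \<Rightarrow> 'a list set struct" where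
  "internal_model M \<iota> =
     \<lparr>universe = idom M \<iota> // ieq M \<iota>,
      addition = (\<lambda>X Y. THE Z. Z \<in> idom M \<iota> // ieq M \<iota> \<and> iadd M \<iota> X Y Z)\<rparr>"

text \<open>
  \<open>F(x, y)\<close>, with \<open>x\<close> an \<open>m\<close>-tuple representing an element of the internal model, defines the
  graph of \<open>h\<close>.
\<close>

definition defines_map ::
  "'a struct \<Rightarrow> interp \<Rightarrow> fm \<Rightarrow> ('a list set \<Rightarrow> 'a) \<Rightarrow> bool" where
  "defines_map M \<iota> F h \<longleftrightarrow>
     fv F \<subseteq> {..dim \<iota>} \<and>
     def_set M (dim \<iota> + 1) F = {x @ [h (ieq M \<iota> `` {x})] | x. x \<in> idom M \<iota>}"

end

theory Submission
  imports Defs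
begin

text \<open>
  The only input from quantifier elimination is that a definable set of natural numbers is
  eventually periodic; it forces definable functions on \<open>\<nat>\<close> to grow at most linearly. Give an
  element of the internal model \<open>\<AA>\<close> as rank the least norm of a tuple representing it, so that at
  most \<open>(n + 1) ^ m\<close> elements have rank \<open>\<le> n\<close>. Finiteness of an initial segment of \<open>\<AA>\<close> is the
  same as boundedness of ranks, so standardness of elements is definable.

  If \<open>\<AA>\<close> has nonstandard elements, the least nonstandard element of rank \<open>\<le> n\<close> gives a definable
  decreasing sequence; by linear growth, terms of index \<open>K n\<close> already lie below all gaps up to
  index \<open>n\<close>. Hence sums of \<open>m + 1\<close> terms at increasing scales are pairwise distinct, and there are
  about \<open>n ^ (m + 1)\<close> of them of rank \<open>O(n)\<close>, which is too many.

  If \<open>\<AA>\<close> is standard, the least element of rank \<open>> n\<close> is an unbounded definable function \<open>\<nat> \<rightarrow> \<AA>\<close> of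
  polynomial growth. Passing to differences of running maxima lowers the degree of growth as long as
  the differences are unbounded; once they are bounded, they are eventually periodic, and the
  function is linear along an arithmetic progression. A linear definable function \<open>\<nat> \<rightarrow> \<AA>\<close> of positive
  slope defines the isomorphism.
\<close>

section \<open>Definable relations on the natural numbers\<close>

lemma val_cong: "(\<And>i. i \<in> fv_trm t \<Longrightarrow> e i = e' i) \<Longrightarrow> val M e t = val M e' t"
  by (induction t) auto

lemma sat_cong: "(\<And>i. i \<in> fv \<phi> \<Longrightarrow> e i = e' i) \<Longrightarrow> sat M e \<phi> = sat M e' \<phi>"
proof (induction \<phi> arbitrary: e e')
  case (Eq s t)
  then have "val M e s = val M e' s" "val M e t = val M e' t"
    by (auto intro!: val_cong)
  then show ?case by simp
next
  case (Neg \<phi>)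
  then show ?case by (metis fv.simps(2) sat.simps(2))
next
  case (Conj \<phi> \<psi>)
  then show ?case by (metis UnCI fv.simps(3) sat.simps(3))
next
  case (Ex i \<phi>)
  have "sat M (e(i := a)) \<phi> = sat M (e'(i := a)) \<phi>" for a
    using Ex.prems by (intro Ex.IH) auto
  then show ?case by simp
qed

lemma finite_subset_lessThan: "finite (S :: nat set) \<Longrightarrow> \<exists>N. S \<subseteq> {..<N}"
  by (metis finite_nat_set_iff_bounded lessThan_iff subsetI)

lemma finite_fv [simp]: "finite (fv \<phi>)"
proof -
  have "finite (fv_trm t)" for t by (induction t) auto
  then show ?thesis by (induction \<phi>) auto
qed

section \<open>Renaming of variables and closure of definability under the logical
  operations\<close>

primrec rename_trm :: "(nat \<Rightarrow> nat) \<Rightarrow> trm \<Rightarrow> trm" where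
  "rename_trm \<sigma> (Var i) = Var (\<sigma> i)"
| "rename_trm \<sigma> (Plus s t) = Plus (rename_trm \<sigma> s) (rename_trm \<sigma> t)"

lemma val_rename_trm: "val M e (rename_trm \<sigma> t) = val M (\<lambda>i. e (\<sigma> i)) t"
  by (induction t) auto

text \<open>Under an arbitrary \<sigma> a free variable could land on the bound one, so the bound
  variable is moved to an index \<open>N\<close> beyond the images of all free variables.
  Generalising over \<sigma> lets the induction use the updated map.\<close>

lemma ex_rename: "\<exists>\<psi>. \<forall>e. sat M e \<psi> = sat M (\<lambda>i. e (\<sigma> i)) \<phi>"
proof (induction \<phi> arbitrary: \<sigma>)
  case (Eq s t)
  show ?case by (rule exI[of _ "Eq (rename_trm \<sigma> s) (rename_trm \<sigma> t)"]) (simp add: val_rename_trm)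
next
  case (Neg \<phi>)
  then show ?case by (metis sat.simps(2))
next
  case (Conj \<phi>1 \<phi>2)
  then show ?case by (metis sat.simps(3))
next
  case (Ex i \<phi>)
  obtain N where N: "\<sigma> ` fv \<phi> \<subseteq> {..<N}"
    by (meson finite_fv finite_imageI finite_subset_lessThan)
  obtain \<psi> where \<psi>: "\<And>e. sat M e \<psi> = sat M (\<lambda>j. e ((\<sigma>(i := N)) j)) \<phi>"
    using Ex.IH by metis
  have "sat M (e(N := a)) \<psi> = sat M ((\<lambda>j. e (\<sigma> j))(i := a)) \<phi>" for e a
    unfolding \<psi> using N by (intro sat_cong) auto
  then show ?case by (intro exI[of _ "Ex N \<psi>"]) simp
qed

definition definable :: "((nat \<Rightarrow> nat) \<Rightarrow> bool) \<Rightarrow> bool" where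
  "definable P \<longleftrightarrow> (\<exists>\<phi>. \<forall>e. sat nat_plus e \<phi> = P e)"

lemma definable_sat: "definable (\<lambda>e. sat nat_plus (\<lambda>i. e (\<sigma> i)) \<phi>)"
  unfolding definable_def using ex_rename by fast

lemma definable_rename: "definable P \<Longrightarrow> definable (\<lambda>e. P (\<lambda>i. e (\<sigma> i)))"
  using definable_sat unfolding definable_def by metis

lemma definable_not: "definable P \<Longrightarrow> definable (\<lambda>e. \<not> P e)"
  unfolding definable_def by (metis sat.simps(2))

lemma definable_conj: "definable P \<Longrightarrow> definable Q \<Longrightarrow> definable (\<lambda>e. P e \<and> Q e)"
  unfolding definable_def by (metis sat.simps(3))

lemma definable_disj: "definable P \<Longrightarrow> definable Q \<Longrightarrow> definable (\<lambda>e. P e \<or> Q e)"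
  using definable_not[OF definable_conj[OF definable_not definable_not]] by simp

text \<open>The bound variable is put in front of the assignment (de Bruijn), so that \<open>intro\<close> can apply
  the rule by pattern unification.\<close>

lemma definable_ex:
  assumes "definable (\<lambda>e. P (\<lambda>i. e (Suc i)) (e 0))"
  shows "definable (\<lambda>e. \<exists>a. P e a)"
proof -
  obtain \<phi> where \<phi>: "\<And>e. sat nat_plus e \<phi> = P (\<lambda>i. e (Suc i)) (e 0)"
    using assms unfolding definable_def by blast
  obtain N where N: "fv \<phi> \<subseteq> {..<N}"
    by (meson finite_fv finite_subset_lessThan)
  obtain \<psi> where \<psi>: "\<And>e. sat nat_plus e \<psi> = sat nat_plus (\<lambda>i. e (case i of 0 \<Rightarrow> N | Suc i \<Rightarrow> i)) \<phi>"
    using ex_rename by metis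
  have "sat nat_plus (e(N := a)) \<psi> = sat nat_plus (case_nat a e) \<phi>" for e a
    unfolding \<psi> using N by (intro sat_cong) (auto split: nat.splits)
  then have "\<forall>e. sat nat_plus e (Ex N \<psi>) = (\<exists>a. P e a)"
    by (simp add: \<phi>) (simp add: nat_plus_def)
  then show ?thesis unfolding definable_def by blast
qed

lemma definable_all:
  "definable (\<lambda>e. P (\<lambda>i. e (Suc i)) (e 0)) \<Longrightarrow> definable (\<lambda>e. \<forall>a. P e a)"
  using definable_not[OF definable_ex, of "\<lambda>e a. \<not> P e a"] definable_not by auto

lemma definable_eq: "definable (\<lambda>e. e i = e j)"
  unfolding definable_def by (rule exI[of _ "Eq (Var i) (Var j)"]) simp

lemma definable_add: "definable (\<lambda>e. e i + e j = e k)"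
  unfolding definable_def by (rule exI[of _ "Eq (Plus (Var i) (Var j)) (Var k)"]) (simp add: nat_plus_def)

lemma definable_True: "definable (\<lambda>e. True)"
  using definable_eq[of 0 0] by simp

lemma definable_All_less:
  "(\<And>j. j < (n::nat) \<Longrightarrow> definable (\<lambda>e. P j e)) \<Longrightarrow> definable (\<lambda>e. \<forall>j<n. P j e)"
  by (induction n) (auto simp: definable_True All_less_Suc intro!: definable_conj)

lemma definable_le: "definable (\<lambda>e. e i \<le> e j)"
proof -
  have "definable (\<lambda>e. \<exists>a. e i + a = e j)"
    by (rule definable_ex) (rule definable_add)
  then show ?thesis by (simp add: le_iff_add eq_commute)
qed

text \<open>The language has neither constants nor a successor; the successor is the immediate upper
  neighbour in the definable order.\<close>

lemma definable_Suc: "definable (\<lambda>e. e i = Suc (e j))"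
proof -
  have "definable (\<lambda>e. e j \<le> e i \<and> \<not> e i \<le> e j \<and> (\<forall>a. e i \<le> a \<or> a \<le> e j))"
    by (intro definable_conj definable_not definable_all definable_disj definable_le)
  moreover have "b = Suc c \<longleftrightarrow> c \<le> b \<and> \<not> b \<le> c \<and> (\<forall>a. b \<le> a \<or> a \<le> c)" for b c :: nat
    by (metis Suc_leI le_SucE not_less_eq_eq nat_le_linear order_refl le_antisym)
  ultimately show ?thesis by simp
qed

lemma definable_const: "definable (\<lambda>e. e i = c)"
proof (induction c arbitrary: i)
  case 0
  \<comment> \<open>Zero is the only solution of this equation; it anchors all other
    constants.\<close>
  have "definable (\<lambda>e. e i + e i = e i)" by (rule definable_add)
  then show ?case by simp
next
  case (Suc c)
  have "definable (\<lambda>e. \<exists>a. a = c \<and> e i = Suc a)"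
    by (intro definable_ex definable_conj Suc.IH definable_Suc)
  then show ?case by simp
qed

section \<open>Back-and-forth equivalence of assignments and eventual periodicity of definable
  sets\<close>

definition eventually_periodic :: "nat set \<Rightarrow> bool" where
  "eventually_periodic S \<longleftrightarrow> (\<exists>q>0. \<exists>N. \<forall>n\<ge>N. n + q \<in> S \<longleftrightarrow> n \<in> S)"

definition lin :: "nat \<Rightarrow> (nat \<Rightarrow> int) \<Rightarrow> int \<Rightarrow> (nat \<Rightarrow> nat) \<Rightarrow> int" where
  "lin k c d e = (\<Sum>i<k. c i * int (e i)) + d"

text \<open>The back-and-forth relation that replaces quantifier elimination: the atomic conditions
  of bounded size are signs of affine forms and congruences. A larger \<open>C\<close> and a
  multiple of \<open>L\<close> make it finer.\<close>

definition sim :: "nat \<Rightarrow> int \<Rightarrow> int \<Rightarrow> (nat \<Rightarrow> nat) \<Rightarrow> (nat \<Rightarrow> nat) \<Rightarrow> bool" where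
  "sim k C L e e' \<longleftrightarrow>
     (\<forall>c d. (\<forall>i. \<bar>c i\<bar> \<le> C) \<and> \<bar>d\<bar> \<le> C \<longrightarrow> sgn (lin k c d e) = sgn (lin k c d e')) \<and>
     (\<forall>i<k. L dvd int (e' i) - int (e i))"

lemma sim_sym: "sim k C L e e' \<Longrightarrow> sim k C L e' e"
  unfolding sim_def by (metis dvd_minus_iff minus_diff_eq)

lemma sim_mono: "sim k C L e e' \<Longrightarrow> C0 \<le> C \<Longrightarrow> L0 dvd L \<Longrightarrow> sim k C0 L0 e e'"
  unfolding sim_def by (meson dvd_trans order_trans)

lemma lin_diff: "lin k c d e - lin k c' d' e = lin k (\<lambda>i. c i - c' i) (d - d') e"
  by (simp add: lin_def sum_subtractf left_diff_distrib)

lemma lin_mult: "x * lin k c d e = lin k (\<lambda>i. x * c i) (x * d) e"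
  by (simp add: lin_def sum_distrib_left ring_distribs mult.assoc)

lemma lin_upd: "i < k \<Longrightarrow> lin k c d (e(i := a)) = c i * int a + lin k (c(i := 0)) d e"
proof -
  assume "i < k"
  then have "{..<k} = insert i ({..<k} - {i})" by auto
  then have split: "(\<Sum>j<k. g j) = g i + (\<Sum>j\<in>{..<k} - {i}. g j)" for g :: "nat \<Rightarrow> int"
    by (metis finite_Diff finite_lessThan insert_Diff_single sum.insert_remove Diff_idemp)
  show ?thesis
    unfolding lin_def by (subst (1 2) split) (auto intro: sum.cong)
qed

lemma lin_dvd: "(\<And>i. i < k \<Longrightarrow> L dvd int (e' i) - int (e i)) \<Longrightarrow> L dvd lin k c d e' - lin k c d e"
proof -
  assume *: "\<And>i. i < k \<Longrightarrow> L dvd int (e' i) - int (e i)"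
  have "lin k c d e' - lin k c d e = (\<Sum>i<k. c i * (int (e' i) - int (e i)))"
    by (simp add: lin_def sum_subtractf right_diff_distrib)
  then show ?thesis using * by (auto intro!: dvd_sum)
qed

text \<open>Any \<open>a\<close> sits, after scaling by \<open>B\<close>, directly above some form \<open>t\<close> in the remaining
  variables; \<open>a'\<close> is placed above the value of the same form at \<open>e'\<close>, at the least admissible
  distance in the right residue class.\<close>

lemma sim_extend:
  fixes C L :: int
  assumes "C \<ge> 1" "L \<ge> 1"
  shows "\<exists>C'\<ge>1. \<exists>L'\<ge>1. \<forall>e e'. sim k C' L' e e' \<longrightarrow>
    (\<forall>i<k. \<forall>a. \<exists>a'. sim k C L (e(i := a)) (e'(i := a')))"
proof -
  \<comment> \<open>Every nonzero coefficient of size at most \<open>C\<close> divides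
    \<open>B\<close>, so each comparison of \<open>c i * a\<close> with a form turns into one of
    \<open>B * a\<close> with a multiple of that form, of coefficients at most
    \<open>B * C\<close>.\<close>
  define B :: int where "B = fact (nat C)"
  have B: "B \<ge> 1" unfolding B_def by (rule fact_ge_1)
  have Bdvd: "b dvd B" if "\<bar>b\<bar> \<le> C" "b \<noteq> 0" for b
  proof -
    have "nat \<bar>b\<bar> dvd fact (nat C)" using that by (intro dvd_fact) auto
    then have "int (nat \<bar>b\<bar>) dvd int (fact (nat C))" by (simp only: int_dvd_int_iff)
    then show ?thesis by (simp add: B_def)
  qed
  \<comment> \<open>Differences of two forms bounded by \<open>B * C\<close> are bounded by
    \<open>2 * (B * C)\<close>; the summand \<open>B * L\<close> leaves room for shifting the
    constant by the distance \<open>r\<close> below.\<close>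
  define C' where "C' = 2 * (B * C) + B * L"
  have BC: "B * C \<ge> C" using B assms by simp
  have BL: "B * L \<ge> 1" using B assms by (metis mult_mono' mult_1 zero_le_one)
  have C'1: "C' \<ge> 1" "C' \<ge> C" using BC BL assms unfolding C'_def by linarith+
  have main: "\<exists>a'. sim k C L (e(i := a)) (e'(i := a'))"
    if s: "sim k C' (B * L) e e'" and i: "i < k" for e e' i a
  proof -
    have sg: "sgn (lin k c d e) = sgn (lin k c d e')" if "\<forall>i. \<bar>c i\<bar> \<le> C'" "\<bar>d\<bar> \<le> C'" for c d
      using s that unfolding sim_def by blast
    have dv: "\<And>i. i < k \<Longrightarrow> B * L dvd int (e' i) - int (e i)" using s unfolding sim_def by blast
    \<comment> \<open>These are the bounded forms whose value at \<open>e\<close> does not exceed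
      \<open>B * a\<close>; the zero form is one of them. The pair \<open>p\<close> attains the
      largest such value.\<close>
    define T where "T = (\<lambda>(c, d). (\<forall>i. \<bar>c i\<bar> \<le> B * C) \<and> \<bar>d\<bar> \<le> B * C \<and> lin k c d e \<le> B * int a)"
    have "T (\<lambda>_. 0, 0)" using B BC assms by (auto simp: T_def lin_def)
    then obtain p where p: "T p" "\<And>y. T y \<Longrightarrow> nat (B * int a - lin k (fst p) (snd p) e) \<le> nat (B * int a - lin k (fst y) (snd y) e)"
      using ex_has_least_nat[of T _ "\<lambda>y. nat (B * int a - lin k (fst y) (snd y) e)"] by blast
    obtain cl dl where pp: "p = (cl, dl)" by fastforce
    define tl tl' where "tl = lin k cl dl e" and "tl' = lin k cl dl e'"
    have cl: "\<And>i. \<bar>cl i\<bar> \<le> B * C" "\<bar>dl\<bar> \<le> B * C" "tl \<le> B * int a"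
      using p(1) by (auto simp: T_def pp tl_def)
    have least: "lin k c d e \<le> tl" if "\<forall>i. \<bar>c i\<bar> \<le> B * C" "\<bar>d\<bar> \<le> B * C" "lin k c d e \<le> B * int a" for c d
      using p(2)[of "(c, d)"] that cl by (auto simp: T_def pp tl_def)
    define \<delta> where "\<delta> = B * int a - tl"
    \<comment> \<open>The representative of \<delta> modulo \<open>B * L\<close> between 1 and
      \<open>B * L\<close>, except that it vanishes together with \<delta>: equality with the form
      \<open>tl\<close> and strict excess over it must both be preserved.\<close>
    define r where "r = (if \<delta> = 0 then 0 else (\<delta> - 1) mod (B * L) + 1)"
    have \<delta>0: "\<delta> \<ge> 0" using cl by (simp add: \<delta>_def)
    have r: "0 \<le> r \<and> r \<le> B * L \<and> r \<le> \<delta> \<and> (r = 0 \<longleftrightarrow> \<delta> = 0) \<and> B * L dvd r - \<delta>"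
    proof (cases "\<delta> = 0")
      case True
      then show ?thesis using BL by (simp add: r_def)
    next
      case False
      define M where "M = B * L"
      have "0 \<le> (\<delta> - 1) mod M" "(\<delta> - 1) mod M < M" "(\<delta> - 1) mod M \<le> \<delta> - 1"
        using BL \<delta>0 False zmod_le_nonneg_dividend[of "\<delta> - 1" M] unfolding M_def by simp_all
      moreover have "M dvd ((\<delta> - 1) mod M + 1) - \<delta>"
        using dvd_minus_mod[of M "\<delta> - 1"] by (simp add: dvd_diff_commute algebra_simps)
      moreover have "r = (\<delta> - 1) mod M + 1" using False by (simp add: r_def M_def)
      ultimately show ?thesis using False \<delta>0 unfolding M_def[symmetric] by auto
    qed
    have "B * L dvd (tl' - tl) + (r - \<delta>)"
      using lin_dvd[of k "B * L" e' e cl dl] dv r unfolding tl_def tl'_def by (intro dvd_add) auto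
    then obtain z where z: "(tl' - tl) + (r - \<delta>) = B * L * z" by blast
    define a' where "a' = int a + L * z"
    have a': "B * a' = tl' + r" using z by (simp add: a'_def \<delta>_def algebra_simps)
    \<comment> \<open>A form not above \<open>B * a\<close> is at most \<open>tl\<close> by the
      choice of \<open>p\<close>, and the order of these two is the same at \<open>e'\<close>. A
      form above \<open>B * a\<close> exceeds \<open>tl + r\<close>, and this comparison is again
      within the bound \<open>C'\<close>.\<close>
    have T: "sgn (B * int a - lin k c d e) = sgn (B * a' - lin k c d e')"
      if cd: "\<forall>i. \<bar>c i\<bar> \<le> B * C" "\<bar>d\<bar> \<le> B * C" for c d
    proof (cases "lin k c d e \<le> B * int a")
      case True
      then have le: "lin k c d e \<le> tl" using least cd by blast
      have "\<bar>cl i - c i\<bar> \<le> C'" "\<bar>dl - d\<bar> \<le> C'" for i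
        using cl(1)[of i] cl(2) cd(1)[rule_format, of i] cd(2) BL unfolding C'_def by linarith+
      then have "sgn (tl - lin k c d e) = sgn (tl' - lin k c d e')"
        unfolding tl_def tl'_def lin_diff by (intro sg) auto
      then show ?thesis using le a' r cl(3) \<delta>0 unfolding \<delta>_def
        by (cases "tl = lin k c d e") (auto simp: sgn_if split: if_splits)
    next
      case False
      have b: "\<bar>c i - cl i\<bar> \<le> C'" "\<bar>d - (dl + r)\<bar> \<le> C'" for i
        using cl(1)[of i] cl(2) cd(1)[rule_format, of i] cd(2) BL r unfolding C'_def by linarith+
      have e: "lin k c d f - lin k cl dl f - r = lin k (\<lambda>i. c i - cl i) (d - (dl + r)) f" for f
        unfolding lin_diff by (simp add: lin_def)
      have "sgn (lin k c d e - tl - r) = sgn (lin k c d e' - tl' - r)"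
        unfolding tl_def tl'_def e using b by (intro sg) auto
      moreover have "lin k c d e - tl - r > 0" using False r unfolding \<delta>_def by linarith
      ultimately show ?thesis using a' False by (auto simp: sgn_if split: if_splits)
    qed
    have "sgn (B * int a) = sgn (B * a')"
      using T[of "\<lambda>_. 0" 0] BC assms by (simp add: lin_def)
    then have a'0: "a' \<ge> 0" using B by (auto simp: sgn_if mult_less_0_iff zero_less_mult_iff split: if_splits)
    have "sgn (lin k c d (e(i := a))) = sgn (lin k c d (e'(i := nat a')))"
      if cd: "\<forall>i. \<bar>c i\<bar> \<le> C" "\<bar>d\<bar> \<le> C" for c d
    proof (cases "c i = 0")
      case True
      have "sgn (lin k (c(i := 0)) d e) = sgn (lin k (c(i := 0)) d e')"
        using cd C'1 by (intro sg) (auto intro: order_trans)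
      then show ?thesis using True by (simp add: lin_upd[OF i])
    next
      case False
      \<comment> \<open>Multiplying by \<open>x\<close>, which up to sign is the cofactor of
        \<open>\<bar>c i\<bar>\<close> in \<open>B\<close>, solves the form for
        \<open>B * a\<close>.\<close>
      obtain w where w: "B = \<bar>c i\<bar> * w" using Bdvd[of "c i"] cd False by (metis abs_dvd_iff dvdE)
      have w0: "w > 0" using w B False by (metis abs_ge_zero mult_le_0_iff not_less not_one_le_zero order_trans)
      have wB: "w \<le> B" using w False w0 by (simp add: mult_le_cancel_right2)
      define x where "x = - sgn (c i) * w"
      have x: "\<bar>x\<bar> \<le> B" using False w0 wB by (simp add: x_def abs_mult)
      have ci: "c i = sgn (c i) * \<bar>c i\<bar>" by (simp add: sgn_mult_abs)
      have key: "sgn (lin k c d (f(i := nat y))) = sgn (c i) * sgn (B * y - lin k (\<lambda>j. x * (c(i := 0)) j) (x * d) f)"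
        if "y \<ge> 0" for f y
      proof -
        have "sgn (c i) * (B * y - x * lin k (c(i := 0)) d f)
            = w * (c i * y + lin k (c(i := 0)) d f)"
          using False unfolding w x_def by (cases "c i > 0") (auto simp: algebra_simps sgn_if)
        then have "sgn (sgn (c i) * (B * y - x * lin k (c(i := 0)) d f)) = sgn (lin k c d (f(i := nat y)))"
          using w0 that by (simp add: lin_upd[OF i] sgn_mult)
        then show ?thesis by (simp only: sgn_mult sgn_sgn lin_mult)
      qed
      have "\<bar>x * (c(i := 0)) j\<bar> \<le> B * C" "\<bar>x * d\<bar> \<le> B * C" for j
        using cd x B assms by (auto simp: abs_mult intro!: mult_mono)
      then show ?thesis using key[of "int a" e] key[of a' e'] a'0 T[of "\<lambda>j. x * (c(i := 0)) j" "x * d"]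
        by simp
    qed
    moreover have "L dvd int ((e'(i := nat a')) j) - int ((e(i := a)) j)" if "j < k" for j
      using dv[OF that] a'0 by (auto simp: a'_def dest: dvd_mult_right)
    ultimately have "sim k C L (e(i := a)) (e'(i := nat a'))" unfolding sim_def by blast
    then show ?thesis by blast
  qed
  show ?thesis
    by (rule exI[of _ C'], rule conjI[OF C'1(1)], rule exI[of _ "B * L"]) (use main BL in blast)
qed

lemma val_lin:
  "\<exists>c C. (\<forall>i. \<bar>c i\<bar> \<le> C) \<and> (\<forall>k e. fv_trm t \<subseteq> {..<k} \<longrightarrow> int (val nat_plus e t) = lin k c 0 e)"
proof (induction t)
  case (Var j)
  have "int (e j) = lin k (\<lambda>i. of_bool (i = j)) 0 e" if "j < k" for k e
    using that by (simp add: lin_def of_bool_def if_distrib[of "\<lambda>x. x * _"] cong: if_cong)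
  then show ?case by (intro exI[of _ "\<lambda>i. of_bool (i = j)"] exI[of _ 1]) auto
next
  case (Plus s t)
  then obtain c C c' C' where *: "\<forall>i. \<bar>c i\<bar> \<le> C" "\<forall>i. \<bar>c' i\<bar> \<le> C'"
    "\<forall>k e. fv_trm s \<subseteq> {..<k} \<longrightarrow> int (val nat_plus e s) = lin k c 0 e"
    "\<forall>k e. fv_trm t \<subseteq> {..<k} \<longrightarrow> int (val nat_plus e t) = lin k c' 0 e" by blast
  have "\<bar>c i + c' i\<bar> \<le> C + C'" for i
    using *(1,2) abs_triangle_ineq[of "c i" "c' i"] by (meson add_mono order_trans)
  moreover have "lin k (\<lambda>i. c i + c' i) 0 e = lin k c 0 e + lin k c' 0 e" for k e
    by (simp add: lin_def sum.distrib distrib_right)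
  ultimately show ?case using *
    by (intro exI[of _ "\<lambda>i. c i + c' i"] exI[of _ "C + C'"]) (auto simp: nat_plus_def)
qed

text \<open>Induction on the formula: an equation is the vanishing of a difference of two forms, a
  conjunction takes the larger bound and the product of the moduli, and a quantifier is matched by
  \<open>sim_extend\<close>. The variables seen by \<open>sim\<close> have to include the bound
  ones, hence the threshold \<open>k0\<close>.\<close>

lemma sat_sim:
  "\<exists>k0. \<forall>k\<ge>k0. \<exists>C\<ge>1. \<exists>L\<ge>1. \<forall>e e'. sim k C L e e' \<longrightarrow> sat nat_plus e \<phi> = sat nat_plus e' \<phi>"
proof (induction \<phi>)
  case (Eq s t)
  obtain c C where c: "\<forall>i. \<bar>c i\<bar> \<le> C" "\<And>k e. fv_trm s \<subseteq> {..<k} \<Longrightarrow> int (val nat_plus e s) = lin k c 0 e"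
    using val_lin by metis
  obtain c' C' where c': "\<forall>i. \<bar>c' i\<bar> \<le> C'" "\<And>k e. fv_trm t \<subseteq> {..<k} \<Longrightarrow> int (val nat_plus e t) = lin k c' 0 e"
    using val_lin by metis
  have bd: "\<bar>c i - c' i\<bar> \<le> \<bar>C + C'\<bar> + 1" for i
    using c(1)[rule_format, of i] c'(1)[rule_format, of i] by linarith
  obtain k0 where k0: "fv (Eq s t) \<subseteq> {..<k0}"
    by (meson finite_fv finite_subset_lessThan)
  have "sat nat_plus e (Eq s t) = sat nat_plus e' (Eq s t)" if "k \<ge> k0" "sim k (\<bar>C + C'\<bar> + 1) 1 e e'" for k e e'
  proof -
    have fvs: "fv_trm s \<subseteq> {..<k}" "fv_trm t \<subseteq> {..<k}" using k0 that by auto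
    have "sat nat_plus f (Eq s t) \<longleftrightarrow> sgn (lin k (\<lambda>i. c i - c' i) 0 f) = 0" for f
      using c(2)[OF fvs(1), of f] c'(2)[OF fvs(2), of f] lin_diff[of k c 0 f c' 0]
      unfolding sat.simps sgn_0_0 diff_self by (smt (verit) of_nat_eq_iff)
    then show ?thesis using that(2) bd unfolding sim_def by auto
  qed
  then show ?case by (intro exI[of _ k0] allI impI exI[of _ "\<bar>C + C'\<bar> + 1"] conjI exI[of _ 1]) auto
next
  case (Neg \<phi>)
  then show ?case by simp
next
  case (Conj \<phi> \<psi>)
  then obtain k1 k2 where
    k1: "\<forall>k\<ge>k1. \<exists>C\<ge>1. \<exists>L\<ge>1. \<forall>e e'. sim k C L e e' \<longrightarrow> sat nat_plus e \<phi> = sat nat_plus e' \<phi>" and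
    k2: "\<forall>k\<ge>k2. \<exists>C\<ge>1. \<exists>L\<ge>1. \<forall>e e'. sim k C L e e' \<longrightarrow> sat nat_plus e \<psi> = sat nat_plus e' \<psi>" by blast
  show ?case
  proof (intro exI[of _ "max k1 k2"] allI impI)
    fix k assume k: "k \<ge> max k1 k2"
    obtain C L where 1: "C \<ge> 1" "L \<ge> 1" "\<forall>e e'. sim k C L e e' \<longrightarrow> sat nat_plus e \<phi> = sat nat_plus e' \<phi>"
      using k1 k by auto
    obtain C' L' where 2: "C' \<ge> 1" "L' \<ge> 1" "\<forall>e e'. sim k C' L' e e' \<longrightarrow> sat nat_plus e \<psi> = sat nat_plus e' \<psi>"
      using k2 k by auto
    have "L * L' \<ge> 1" using 1 2 by (metis mult_mono' mult_1 zero_le_one)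
    moreover have "sat nat_plus e (Conj \<phi> \<psi>) = sat nat_plus e' (Conj \<phi> \<psi>)" if "sim k (max C C') (L * L') e e'" for e e'
      using 1(3) 2(3) sim_mono[OF that, of C L] sim_mono[OF that, of C' L'] by auto
    ultimately show "\<exists>C\<ge>1. \<exists>L\<ge>1. \<forall>e e'. sim k C L e e' \<longrightarrow> sat nat_plus e (Conj \<phi> \<psi>) = sat nat_plus e' (Conj \<phi> \<psi>)"
      using 1 by (intro exI[of _ "max C C'"] conjI exI[of _ "L * L'"]) auto
  qed
next
  case (Ex i \<phi>)
  then obtain k1 where
    k1: "\<forall>k\<ge>k1. \<exists>C\<ge>1. \<exists>L\<ge>1. \<forall>e e'. sim k C L e e' \<longrightarrow> sat nat_plus e \<phi> = sat nat_plus e' \<phi>" by blast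
  show ?case
  proof (intro exI[of _ "max k1 (Suc i)"] allI impI)
    fix k assume k: "k \<ge> max k1 (Suc i)"
    obtain C L where 1: "C \<ge> 1" "L \<ge> 1" "\<And>e e'. sim k C L e e' \<Longrightarrow> sat nat_plus e \<phi> = sat nat_plus e' \<phi>"
      using k1[rule_format, of k] k by (metis max.bounded_iff)
    obtain C' L' where 2: "C' \<ge> 1" "L' \<ge> 1" "\<And>e e'. sim k C' L' e e' \<Longrightarrow>
        (\<forall>i<k. \<forall>a. \<exists>a'. sim k C L (e(i := a)) (e'(i := a')))"
      using sim_extend[OF 1(1,2), of k] by blast
    have one: "sat nat_plus e' (Ex i \<phi>)" if s: "sim k C' L' e e'" and x: "sat nat_plus e (Ex i \<phi>)" for e e'
    proof -
      obtain a where a: "sat nat_plus (e(i := a)) \<phi>" using x by auto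
      obtain a' where "sim k C L (e(i := a)) (e'(i := a'))" using 2(3)[OF s] k by (meson Suc_le_eq max.boundedE)
      then have "sat nat_plus (e'(i := a')) \<phi>" using 1(3) a by blast
      then show ?thesis by (auto simp: nat_plus_def)
    qed
    have "\<forall>e e'. sim k C' L' e e' \<longrightarrow> sat nat_plus e (Ex i \<phi>) = sat nat_plus e' (Ex i \<phi>)"
    proof (intro allI impI)
      fix e e' assume s: "sim k C' L' e e'"
      show "sat nat_plus e (Ex i \<phi>) = sat nat_plus e' (Ex i \<phi>)"
        by (rule iffI, erule one[OF s], erule one[OF sim_sym[OF s]])
    qed
    then show "\<exists>C\<ge>1. \<exists>L\<ge>1. \<forall>e e'. sim k C L e e' \<longrightarrow> sat nat_plus e (Ex i \<phi>) = sat nat_plus e' (Ex i \<phi>)"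
      by (intro exI[of _ C'] conjI 2(1) exI[of _ L'] 2(2))
  qed
qed

text \<open>For large \<open>n\<close> the sign of a bounded form is decided by the coefficient of
  variable 0 or, if this is 0, does not involve \<open>n\<close>. Hence \<open>n\<close> and
  \<open>n + L\<close> give equivalent assignments for the modulus \<open>L\<close> of the defining
  formula.\<close>

lemma definable_eventually_periodic:
  assumes "definable P"
  shows "eventually_periodic {n. P (e(0 := n))}"
proof -
  obtain \<phi> where \<phi>: "\<And>e. sat nat_plus e \<phi> \<longleftrightarrow> P e" using assms unfolding definable_def by blast
  obtain k0 where k0: "\<forall>k\<ge>k0. \<exists>C\<ge>1. \<exists>L\<ge>1. \<forall>e e'. sim k C L e e' \<longrightarrow> sat nat_plus e \<phi> = sat nat_plus e' \<phi>"
    using sat_sim by blast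
  define k where "k = Suc k0"
  obtain C L :: int where CL: "C \<ge> 1" "L \<ge> 1" "\<And>e e'. sim k C L e e' \<Longrightarrow> sat nat_plus e \<phi> = sat nat_plus e' \<phi>"
    using k0 unfolding k_def by (meson le_SucI order_refl)
  \<comment> \<open>Bounds the part of any form with coefficients up to \<open>C\<close> that does
    not involve variable 0.\<close>
  define M where "M = (\<Sum>i<k. C * int (e i)) + C"
  have M: "\<bar>lin k (c(0 := 0)) d e\<bar> \<le> M" if c: "\<forall>i. \<bar>c i\<bar> \<le> C" "\<bar>d\<bar> \<le> C" for c d
  proof -
    have "\<bar>\<Sum>i<k. (c(0 := 0)) i * int (e i)\<bar> \<le> (\<Sum>i<k. C * int (e i))"
    proof (rule order_trans[OF sum_abs sum_mono])
      fix i show "\<bar>(c(0 := 0)) i * int (e i)\<bar> \<le> C * int (e i)"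
        using c(1) CL(1) by (auto simp: abs_mult intro!: mult_right_mono)
    qed
    then show ?thesis using c(2) unfolding lin_def M_def by linarith
  qed
  have M0: "M \<ge> 0" using CL(1) unfolding M_def by (intro add_nonneg_nonneg sum_nonneg) auto
  have "P (e(0 := n + nat L)) \<longleftrightarrow> P (e(0 := n))" if n: "n \<ge> nat M + 1" for n
  proof -
    have sg: "sgn (c * int n + x) = sgn (c * int n' + x)" if "n' \<ge> n" "\<bar>x\<bar> \<le> M" for c x n'
    proof -
      have b: "int n > M" "int n' > M" using n that M0 by linarith+
      consider "c = 0" | "c \<ge> 1" | "c \<le> -1" by linarith
      then show ?thesis
      proof cases
        case 2
        then have "1 * int n \<le> c * int n" "1 * int n' \<le> c * int n'" by (intro mult_right_mono; simp)+
        then show ?thesis using b that by (smt (verit) sgn_1_pos)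
      next
        case 3
        then have "c * int n \<le> -1 * int n" "c * int n' \<le> -1 * int n'" by (intro mult_right_mono; simp)+
        then show ?thesis using b that by (smt (verit) sgn_1_neg)
      qed simp
    qed
    have "0 < k" by (simp add: k_def)
    have "sim k C L (e(0 := n)) (e(0 := n + nat L))"
      unfolding sim_def lin_upd[OF \<open>0 < k\<close>]
    proof (intro conjI allI impI)
      fix c :: "nat \<Rightarrow> int" and d :: int assume "(\<forall>i. \<bar>c i\<bar> \<le> C) \<and> \<bar>d\<bar> \<le> C"
      then show "sgn (c 0 * int n + lin k (c(0 := 0)) d e) = sgn (c 0 * int (n + nat L) + lin k (c(0 := 0)) d e)"
        by (intro sg M) auto
    qed (use CL(2) in auto)
    then show ?thesis using CL(3) \<phi> by blast
  qed
  then show ?thesis unfolding eventually_periodic_def using CL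
    by (intro exI[of _ "nat L"] conjI exI[of _ "nat M + 1"]) auto
qed

section \<open>Models with balls of polynomial size\<close>

lemma eventually_periodic_progression:
  assumes "eventually_periodic S" "infinite S"
  obtains q r where "q > 0" "\<And>n. r + q * n \<in> S"
proof -
  obtain q N where q: "q > 0" "\<And>n. n \<ge> N \<Longrightarrow> n + q \<in> S \<longleftrightarrow> n \<in> S"
    using assms(1) unfolding eventually_periodic_def by blast
  obtain r where r: "r \<ge> N" "r \<in> S"
    using assms(2) by (metis finite_nat_set_iff_bounded linorder_not_less)
  have "r + q * n \<in> S" for n
  proof (induction n)
    case (Suc n)
    then show ?case using q(2)[of "r + q * n"] r by (simp add: algebra_simps)
  qed (use r in simp)
  with q that show thesis by blast
qed

text \<open>\<open>dfb P\<close> means that the two-sorted relation \<open>P\<close>, of an assignment of numbers and an assignment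
  of elements of \<open>U\<close>, is definable in \<open>(\<nat>, +)\<close>.\<close>

locale presburger_like =
  fixes U :: "'a set" and add :: "'a \<Rightarrow> 'a \<Rightarrow> 'a" (infixl "\<oplus>" 65)
    and zero one :: 'a and rk :: "'a \<Rightarrow> nat" and m :: nat
    and dfb :: "((nat \<Rightarrow> nat) \<Rightarrow> (nat \<Rightarrow> 'a) \<Rightarrow> bool) \<Rightarrow> bool"
  assumes add_closed [simp]: "x \<in> U \<Longrightarrow> y \<in> U \<Longrightarrow> x \<oplus> y \<in> U"
    and zero_closed [simp]: "zero \<in> U" and one_closed [simp]: "one \<in> U"
    and one_neq_zero: "one \<noteq> zero"
    and assoc: "x \<in> U \<Longrightarrow> y \<in> U \<Longrightarrow> z \<in> U \<Longrightarrow> x \<oplus> y \<oplus> z = x \<oplus> (y \<oplus> z)"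
    and commute: "x \<in> U \<Longrightarrow> y \<in> U \<Longrightarrow> x \<oplus> y = y \<oplus> x"
    and cancel: "x \<in> U \<Longrightarrow> y \<in> U \<Longrightarrow> z \<in> U \<Longrightarrow> x \<oplus> y = x \<oplus> z \<Longrightarrow> y = z"
    and add_zero [simp]: "x \<in> U \<Longrightarrow> x \<oplus> zero = x"
    and add_eq_zero: "x \<in> U \<Longrightarrow> y \<in> U \<Longrightarrow> x \<oplus> y = zero \<Longrightarrow> x = zero"
    and comparable: "x \<in> U \<Longrightarrow> y \<in> U \<Longrightarrow> \<exists>z\<in>U. x \<oplus> z = y \<or> y \<oplus> z = x"
    and pred: "x \<in> U \<Longrightarrow> x \<noteq> zero \<Longrightarrow> \<exists>y\<in>U. x = y \<oplus> one"
    and halve: "x \<in> U \<Longrightarrow> \<exists>y\<in>U. x = y \<oplus> y \<or> x = y \<oplus> y \<oplus> one"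
    and finite_ball: "finite {x \<in> U. rk x \<le> n}"
    and card_ball: "card {x \<in> U. rk x \<le> n} \<le> (n + 1) ^ m"
    and dfb_cong: "(\<And>\<nu> E. (\<And>i. E i \<in> U) \<Longrightarrow> P \<nu> E = Q \<nu> E) \<Longrightarrow> dfb P \<Longrightarrow> dfb Q"
    and dfb_not: "dfb P \<Longrightarrow> dfb (\<lambda>\<nu> E. \<not> P \<nu> E)"
    and dfb_conj: "dfb P \<Longrightarrow> dfb Q \<Longrightarrow> dfb (\<lambda>\<nu> E. P \<nu> E \<and> Q \<nu> E)"
    and dfb_exN: "dfb (\<lambda>\<nu> E. R (\<lambda>i. \<nu> (Suc i)) E (\<nu> 0)) \<Longrightarrow> dfb (\<lambda>\<nu> E. \<exists>a. R \<nu> E a)"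
    and dfb_exE: "dfb (\<lambda>\<nu> E. R' \<nu> (\<lambda>i. E (Suc i)) (E 0)) \<Longrightarrow> dfb (\<lambda>\<nu> E. \<exists>X\<in>U. R' \<nu> E X)"
    and dfb_addN: "dfb (\<lambda>\<nu> E. \<nu> i + \<nu> j = \<nu> k)"
    and dfb_constN: "dfb (\<lambda>\<nu> E. \<nu> i = c)"
    and dfb_addE: "dfb (\<lambda>\<nu> E. E i \<oplus> E j = E k)"
    and dfb_eqE: "dfb (\<lambda>\<nu> E. E i = E j)"
    and dfb_rk: "dfb (\<lambda>\<nu> E. rk (E i) \<le> \<nu> j)"
    and dfb_periodic: "dfb (\<lambda>\<nu> E. \<nu> 0 \<in> S) \<Longrightarrow> eventually_periodic S"
begin

section \<open>Closure rules for definable two-sorted relations\<close>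

named_theorems dfb

lemmas [dfb] = dfb_not dfb_conj dfb_exN dfb_exE dfb_addN dfb_constN dfb_addE dfb_eqE dfb_rk

lemma dfb_disj [dfb]: "dfb P \<Longrightarrow> dfb Q \<Longrightarrow> dfb (\<lambda>\<nu> E. P \<nu> E \<or> Q \<nu> E)"
  using dfb_not[OF dfb_conj[OF dfb_not dfb_not]] by simp

lemma dfb_imp [dfb]: "dfb P \<Longrightarrow> dfb Q \<Longrightarrow> dfb (\<lambda>\<nu> E. P \<nu> E \<longrightarrow> Q \<nu> E)"
  using dfb_not[OF dfb_conj[OF _ dfb_not]] by simp

lemma dfb_allN [dfb]: "dfb (\<lambda>\<nu> E. R (\<lambda>i. \<nu> (Suc i)) E (\<nu> 0)) \<Longrightarrow> dfb (\<lambda>\<nu> E. \<forall>a. R \<nu> E a)"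
  using dfb_not[OF dfb_exN, of "\<lambda>\<nu> E a. \<not> R \<nu> E a"] dfb_not by auto

lemma dfb_allE [dfb]: "dfb (\<lambda>\<nu> E. R \<nu> (\<lambda>i. E (Suc i)) (E 0)) \<Longrightarrow> dfb (\<lambda>\<nu> E. \<forall>X\<in>U. R \<nu> E X)"
  using dfb_not[OF dfb_exE, of "\<lambda>\<nu> E a. \<not> R \<nu> E a"] dfb_not by auto

lemma dfb_leN [dfb]: "dfb (\<lambda>\<nu> E. \<nu> i \<le> \<nu> j)"
proof -
  have "dfb (\<lambda>\<nu> E. \<exists>a. \<nu> i + a = \<nu> j)" by (intro dfb)
  then show ?thesis by (simp add: le_iff_add eq_commute)
qed

lemma dfb_lessN [dfb]: "dfb (\<lambda>\<nu> E. \<nu> i < \<nu> j)"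
proof -
  have "dfb (\<lambda>\<nu> E. \<not> \<nu> j \<le> \<nu> i)" by (intro dfb)
  then show ?thesis by (simp add: not_le)
qed

lemma dfb_SucN [dfb]: "dfb (\<lambda>\<nu> E. \<nu> i = Suc (\<nu> j))"
proof -
  have "dfb (\<lambda>\<nu> E. \<exists>a. a = 1 \<and> \<nu> j + a = \<nu> i)" by (intro dfb)
  then show ?thesis by (simp add: eq_commute)
qed

lemma dfb_affine [dfb]: "dfb (\<lambda>\<nu> E. \<nu> j = r + q * \<nu> i)"
proof (induction q arbitrary: i j)
  case 0
  then show ?case by (simp add: dfb_constN)
next
  case (Suc q)
  have "dfb (\<lambda>\<nu> E. \<exists>s. s = r + q * \<nu> i \<and> s + \<nu> i = \<nu> j)" by (intro dfb Suc.IH)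
  then show ?case by (simp add: algebra_simps eq_commute)
qed

text \<open>Let \<open>A n\<close> be the least number up to which all \<open>j \<le> n\<close> have
  witnesses. The function \<open>F n = n + A n\<close> is strictly increasing with definable, hence
  eventually periodic, range; so the gaps between consecutive values are eventually bounded, and
  \<open>F\<close> grows linearly.\<close>

lemma linear_bound:
  assumes [dfb]: "\<And>i j. dfb (\<lambda>\<nu> E. R (\<nu> i) (\<nu> j))" and total: "\<And>n. \<exists>i. R n i"
  obtains K where "K \<ge> 1" "\<And>n. \<exists>i \<le> K * (n + 1). R n i"
proof -
  define Q where "Q n a \<longleftrightarrow> (\<forall>j\<le>n. \<exists>i\<le>a. R j i)" for n a
  define A where "A n = (LEAST a. Q n a)" for n
  define F where "F n = n + A n" for n
  have "\<exists>a. Q n a" for n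
  proof (induction n)
    case 0
    then show ?case using total[of 0] by (auto simp: Q_def)
  next
    case (Suc n)
    then obtain a where "Q n a" by blast
    moreover obtain i where "R (Suc n) i" using total by blast
    ultimately have "Q (Suc n) (max a i)" unfolding Q_def by (metis le_SucE max.cobounded2 max.coboundedI1)
    then show ?case by blast
  qed
  then have QA: "Q n (A n)" for n unfolding A_def by (rule LeastI_ex)
  have Ale: "A n \<le> b" if "Q n b" for n b using that unfolding A_def by (rule Least_le)
  have "A n \<le> A (Suc n)" for n using QA[of "Suc n"] by (intro Ale) (auto simp: Q_def)
  then have F: "F n < F (Suc n)" for n unfolding F_def by (metis add_less_le_mono lessI)
  then have mono: "strict_mono F" by (simp add: strict_mono_Suc_iff)
  have range: "range F = {y. \<exists>n a. n + a = y \<and> Q n a \<and> (\<forall>b. Q n b \<longrightarrow> a \<le> b)}" (is "_ = ?S")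
  proof (intro equalityI subsetI)
    fix y assume "y \<in> ?S"
    then obtain n a where "n + a = y" "Q n a" "\<forall>b. Q n b \<longrightarrow> a \<le> b" by blast
    moreover from this have "a = A n" using QA Ale by (meson order.antisym)
    ultimately show "y \<in> range F" by (auto simp: F_def)
  qed (use QA Ale in \<open>unfold F_def, blast\<close>)
  have "dfb (\<lambda>\<nu> E. \<nu> 0 \<in> ?S)" unfolding Q_def mem_Collect_eq by (intro dfb)
  then have "eventually_periodic (range F)" unfolding range by (rule dfb_periodic)
  then obtain q N where q: "\<And>n. n \<ge> N \<Longrightarrow> n + q \<in> range F \<longleftrightarrow> n \<in> range F" "q > 0"
    unfolding eventually_periodic_def by blast
  \<comment> \<open>Along with \<open>F n\<close>, the number \<open>F n + q\<close> is in the
    range. It is a later value of the strictly increasing \<open>F\<close>, so the next value is no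
    larger.\<close>
  have step: "F (Suc n) \<le> F n + q" if "n \<ge> N" for n
  proof -
    have "F n \<ge> N" using that F_def by simp
    then obtain n' where n': "F n + q = F n'" using q(1)[of "F n"] by auto
    then have "n < n'" using mono q(2) by (metis less_add_same_cancel1 strict_mono_less)
    then show ?thesis using mono n' by (simp add: strict_mono_less_eq)
  qed
  have ub: "F (N + k) \<le> F N + q * k" for k
  proof (induction k)
    case (Suc k)
    then show ?case using step[of "N + k"] by simp
  qed simp
  have F_le: "F n \<le> F N + q * n" for n
  proof (cases "n \<le> N")
    case True
    then have "F n \<le> F N" using mono by (simp add: strict_mono_less_eq)
    then show ?thesis by simp
  next
    case False
    then have "F n \<le> F N + q * (n - N)" using ub[of "n - N"] by simp
    also have "\<dots> \<le> F N + q * n" by simp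
    finally show ?thesis .
  qed
  show thesis
  proof (rule that[of "F N + q + 1"])
    fix n
    obtain i where i: "i \<le> A n" "R n i" using QA unfolding Q_def by blast
    have "F N + q * n \<le> (F N + q + 1) * (n + 1)" by (simp add: algebra_simps)
    then have "i \<le> (F N + q + 1) * (n + 1)" using i(1) F_le[of n] unfolding F_def by linarith
    then show "\<exists>i\<le>(F N + q + 1) * (n + 1). R n i" using i by blast
  qed simp
qed

section \<open>The discrete linear order of the model\<close>

definition le (infix "\<sqsubseteq>" 50) where "x \<sqsubseteq> y \<longleftrightarrow> (\<exists>z\<in>U. x \<oplus> z = y)"

definition lt (infix "\<sqsubset>" 50) where "x \<sqsubset> y \<longleftrightarrow> x \<sqsubseteq> y \<and> x \<noteq> y"

lemma dfb_le [dfb]: "dfb (\<lambda>\<nu> E. E i \<sqsubseteq> E j)"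
  unfolding le_def by (intro dfb)

lemma dfb_lt [dfb]: "dfb (\<lambda>\<nu> E. E i \<sqsubset> E j)"
  unfolding lt_def by (intro dfb)

lemma le_add: "x \<in> U \<Longrightarrow> y \<in> U \<Longrightarrow> x \<sqsubseteq> x \<oplus> y"
  unfolding le_def by blast

lemma le_refl [simp]: "x \<in> U \<Longrightarrow> x \<sqsubseteq> x"
  by (metis le_add add_zero zero_closed)

lemma le_trans: "x \<in> U \<Longrightarrow> x \<sqsubseteq> y \<Longrightarrow> y \<sqsubseteq> z \<Longrightarrow> x \<sqsubseteq> z"
  unfolding le_def by (metis add_closed assoc)

lemma le_antisym: "x \<in> U \<Longrightarrow> x \<sqsubseteq> y \<Longrightarrow> y \<sqsubseteq> x \<Longrightarrow> x = y"
  unfolding le_def by (metis add_closed add_eq_zero add_zero assoc cancel zero_closed)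

lemma le_total: "x \<in> U \<Longrightarrow> y \<in> U \<Longrightarrow> x \<sqsubseteq> y \<or> y \<sqsubseteq> x"
  unfolding le_def using comparable by blast

lemma not_le: "x \<in> U \<Longrightarrow> y \<in> U \<Longrightarrow> \<not> x \<sqsubseteq> y \<longleftrightarrow> y \<sqsubset> x"
  unfolding lt_def using le_total le_antisym by blast

lemma le_lt_trans: "x \<in> U \<Longrightarrow> y \<in> U \<Longrightarrow> x \<sqsubseteq> y \<Longrightarrow> y \<sqsubset> z \<Longrightarrow> x \<sqsubset> z"
  unfolding lt_def using le_trans le_antisym by blast

lemma lt_le_trans: "x \<in> U \<Longrightarrow> y \<in> U \<Longrightarrow> x \<sqsubset> y \<Longrightarrow> y \<sqsubseteq> z \<Longrightarrow> x \<sqsubset> z"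
  unfolding lt_def using le_trans le_antisym by blast

lemma add_le_mono: "x \<in> U \<Longrightarrow> y \<in> U \<Longrightarrow> y \<sqsubseteq> z \<Longrightarrow> x \<oplus> y \<sqsubseteq> x \<oplus> z"
  unfolding le_def by (metis assoc)

lemma add_lt_mono: "x \<in> U \<Longrightarrow> y \<in> U \<Longrightarrow> z \<in> U \<Longrightarrow> y \<sqsubset> z \<Longrightarrow> x \<oplus> y \<sqsubset> x \<oplus> z"
  unfolding lt_def by (metis add_le_mono cancel)

lemma add_le_cancel: "x \<in> U \<Longrightarrow> y \<in> U \<Longrightarrow> z \<in> U \<Longrightarrow> x \<oplus> y \<sqsubseteq> x \<oplus> z \<longleftrightarrow> y \<sqsubseteq> z"
  by (metis add_le_mono add_lt_mono not_le le_antisym lt_def add_closed)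

lemma zero_le [simp]: "x \<in> U \<Longrightarrow> zero \<sqsubseteq> x"
  unfolding le_def by (metis add_zero commute zero_closed)

lemma finite_has_least:
  assumes "finite S" "S \<noteq> {}" "S \<subseteq> U"
  shows "\<exists>x\<in>S. \<forall>y\<in>S. x \<sqsubseteq> y"
  using assms
proof (induction S rule: finite_ne_induct)
  case (insert a S)
  then obtain x where x: "x \<in> S" "\<And>y. y \<in> S \<Longrightarrow> x \<sqsubseteq> y" by auto
  have "x \<in> U" "a \<in> U" using insert x by auto
  then show ?case using le_total[of a x] le_trans[of a x] x by (metis insert_iff le_refl)
qed auto

section \<open>Standard elements\<close>

definition std where "std x \<longleftrightarrow> finite {y \<in> U. y \<sqsubseteq> x}"

text \<open>Balls are finite, so finiteness of an initial segment amounts to a bound on ranks.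
  Unlike finiteness, such a bound is expressible with quantifiers over numbers and elements.\<close>

lemma std_iff: "std x \<longleftrightarrow> (\<exists>b. \<forall>y\<in>U. y \<sqsubseteq> x \<longrightarrow> rk y \<le> b)"
proof
  assume s: "std x"
  then have "rk y \<le> Max (rk ` {y \<in> U. y \<sqsubseteq> x})" if "y \<in> U" "y \<sqsubseteq> x" for y
    using that unfolding std_def by (intro Max_ge) auto
  then show "\<exists>b. \<forall>y\<in>U. y \<sqsubseteq> x \<longrightarrow> rk y \<le> b" by blast
next
  assume "\<exists>b. \<forall>y\<in>U. y \<sqsubseteq> x \<longrightarrow> rk y \<le> b"
  then obtain b where "{y \<in> U. y \<sqsubseteq> x} \<subseteq> {y \<in> U. rk y \<le> b}" by blast
  then show "std x" unfolding std_def using finite_ball finite_subset by blast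
qed

lemma dfb_std [dfb]: "dfb (\<lambda>\<nu> E. std (E i))"
  unfolding std_iff by (intro dfb)

lemma std_le: "x \<in> U \<Longrightarrow> y \<in> U \<Longrightarrow> x \<sqsubseteq> y \<Longrightarrow> std y \<Longrightarrow> std x"
  unfolding std_def by (erule finite_subset[rotated]) (auto intro: le_trans)

text \<open>An element up to \<open>x \<oplus> y\<close> is either up to \<open>x\<close>, or the
  sum of \<open>x\<close> and an element up to \<open>y\<close>.\<close>

lemma std_add:
  assumes "x \<in> U" "y \<in> U" "std x" "std y"
  shows "std (x \<oplus> y)"
proof -
  have "{z \<in> U. z \<sqsubseteq> x \<oplus> y} \<subseteq> {z \<in> U. z \<sqsubseteq> x} \<union> (\<lambda>z. x \<oplus> z) ` {z \<in> U. z \<sqsubseteq> y}"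
  proof
    fix z assume z: "z \<in> {z \<in> U. z \<sqsubseteq> x \<oplus> y}"
    show "z \<in> {z \<in> U. z \<sqsubseteq> x} \<union> (\<lambda>z. x \<oplus> z) ` {z \<in> U. z \<sqsubseteq> y}"
    proof (cases "z \<sqsubseteq> x")
      case False
      then obtain w where "w \<in> U" "z = x \<oplus> w" using le_total z assms unfolding le_def by blast
      then show ?thesis using z assms add_le_cancel by auto
    qed (use z in auto)
  qed
  then show ?thesis using assms unfolding std_def by (metis (no_types, lifting) finite_UnI finite_imageI finite_subset)
qed

lemma std_zero [simp]: "std zero"
proof -
  have "{y \<in> U. y \<sqsubseteq> zero} \<subseteq> {zero}" using le_antisym by force
  then show ?thesis unfolding std_def by (rule finite_subset) simp
qed

lemma lt_add_one: "x \<in> U \<Longrightarrow> x \<sqsubset> x \<oplus> one"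
  unfolding lt_def using le_add[of x one] cancel[of x zero one] one_neq_zero by auto

lemma lt_add_one_iff:
  assumes "x \<in> U" "y \<in> U"
  shows "y \<sqsubset> x \<oplus> one \<longleftrightarrow> y \<sqsubseteq> x"
proof
  assume "y \<sqsubset> x \<oplus> one"
  then obtain z where z: "z \<in> U" "y \<oplus> z = x \<oplus> one" "z \<noteq> zero"
    unfolding lt_def le_def using assms by force
  then obtain w where w: "w \<in> U" "z = w \<oplus> one" using pred by blast
  then have "one \<oplus> (y \<oplus> w) = one \<oplus> x" using z assms
    by (metis add_closed assoc commute one_closed)
  then have "y \<oplus> w = x" using w assms cancel[of one "y \<oplus> w" x] by auto
  then show "y \<sqsubseteq> x" using w unfolding le_def by blast
next
  assume "y \<sqsubseteq> x"
  then show "y \<sqsubset> x \<oplus> one" using le_lt_trans lt_add_one assms by blast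
qed

lemma std_one: "std one"
proof -
  have "{y \<in> U. y \<sqsubseteq> one} \<subseteq> {zero, one}"
  proof
    fix y assume y: "y \<in> {y \<in> U. y \<sqsubseteq> one}"
    have o: "zero \<oplus> one = one" using commute[of zero one] by simp
    have "y \<sqsubset> one \<Longrightarrow> y = zero" using lt_add_one_iff[of zero y] y le_antisym[of y zero] unfolding o by auto
    then show "y \<in> {zero, one}" using y unfolding lt_def by blast
  qed
  then show ?thesis unfolding std_def by (rule finite_subset) simp
qed

text \<open>Half of a nonstandard element is nonstandard, since standard elements are closed under
  addition and \<open>one\<close> is standard.\<close>

lemma nonstd_halve:
  assumes "x \<in> U" "\<not> std x"
  obtains y z where "y \<in> U" "z \<in> U" "\<not> std y" "\<not> std z" "x = y \<oplus> z"
proof -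
  obtain y where y: "y \<in> U" "x = y \<oplus> y \<or> x = y \<oplus> y \<oplus> one" using halve assms by blast
  then have "\<not> std y" using assms std_add std_one add_closed one_closed by metis
  moreover have "\<not> std (y \<oplus> one)" using calculation std_le le_add y one_closed add_closed by blast
  ultimately show thesis using y that[of y y] that[of y "y \<oplus> one"] assoc by force
qed

section \<open>Decreasing sequences of nonstandard elements\<close>

lemma sum_gap:
  assumes "\<And>j. f j \<in> U" "\<And>j. j \<ge> N \<Longrightarrow> \<exists>z\<in>U. std z \<and> f (Suc j) \<oplus> z = f j"
  shows "\<exists>z\<in>U. std z \<and> f (N + k) \<oplus> z = f N"
proof (induction k)
  case 0
  show ?case using assms by (intro bexI[of _ zero]) auto
next
  case (Suc k)
  then obtain z where z: "z \<in> U" "std z" "f (N + k) \<oplus> z = f N" by blast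
  obtain w where w: "w \<in> U" "std w" "f (Suc (N + k)) \<oplus> w = f (N + k)" using assms(2)[of "N + k"] by auto
  have "f (Suc (N + k)) \<oplus> (w \<oplus> z) = f N" using z w assms(1) by (metis assoc)
  then show ?case using z w std_add by (intro bexI[of _ "w \<oplus> z"]) auto
qed

text \<open>The least nonstandard elements \<open>f n\<close> of rank at most \<open>n + n0\<close>
  are thinned out to an arithmetic progression of indices at which the gaps are nonstandard. Such a
  progression exists because the set \<open>T\<close> of indices with a nonstandard gap is definable
  and infinite.\<close>

lemma nonstd_sequence:
  assumes c: "c \<in> U" "\<not> std c"
  obtains \<phi> C where "\<And>i j. dfb (\<lambda>\<nu> E. E j = \<phi> (\<nu> i))" "\<And>n. \<phi> n \<in> U" "\<And>n. \<not> std (\<phi> n)"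
    "\<And>n. rk (\<phi> n) \<le> C * (n + 1)" "\<And>n. \<exists>z\<in>U. \<not> std z \<and> \<phi> (Suc n) \<oplus> z = \<phi> n"
    "\<And>x. x \<in> U \<Longrightarrow> \<not> std x \<Longrightarrow> \<exists>n. \<phi> n \<sqsubseteq> x"
proof -
  \<comment> \<open>This offset puts \<open>c\<close> into every ball, so that a least nonstandard
    element exists for all \<open>n\<close>.\<close>
  define n0 where "n0 = rk c"
  \<comment> \<open>The rules for \<open>dfb\<close> accept only variables as arguments of atoms;
    compound expressions such as \<open>n + n0\<close> therefore get names by quantifiers, here and
    in similar definitions below.\<close>
  define isf where "isf n x \<longleftrightarrow> \<not> std x \<and> (\<exists>k s. k = n0 \<and> n + k = s \<and> rk x \<le> s \<and>
    (\<forall>y\<in>U. \<not> std y \<and> rk y \<le> s \<longrightarrow> x \<sqsubseteq> y))" for n x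
  have isf: "isf n x \<longleftrightarrow> \<not> std x \<and> rk x \<le> n + n0 \<and> (\<forall>y\<in>U. \<not> std y \<and> rk y \<le> n + n0 \<longrightarrow> x \<sqsubseteq> y)" for n x
    unfolding isf_def by auto
  define f where "f n = (SOME x. x \<in> U \<and> isf n x)" for n
  have "\<exists>x. x \<in> U \<and> isf n x" for n
  proof -
    let ?S = "{x \<in> {x \<in> U. rk x \<le> n + n0}. \<not> std x}"
    have "finite ?S" using finite_ball[of "n + n0"] by (rule finite_subset[rotated]) auto
    moreover have "c \<in> ?S" using c n0_def by simp
    ultimately show ?thesis using finite_has_least[of ?S] unfolding isf by blast
  qed
  then have f0: "f n \<in> U \<and> isf n (f n)" for n unfolding f_def by (rule someI_ex)
  have f: "f n \<in> U" "\<not> std (f n)" "rk (f n) \<le> n + n0" for n using f0 isf by blast+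
  have f_le: "f n \<sqsubseteq> y" if "y \<in> U" "\<not> std y" "rk y \<le> n + n0" for n y using f0 isf that by blast
  have f_eq: "isf n x \<longleftrightarrow> x = f n" if "x \<in> U" for n x
    using f0 isf that le_antisym by blast
  have dfb_f [dfb]: "dfb (\<lambda>\<nu> E. E j = f (\<nu> i))" for i j
  proof (rule dfb_cong)
    show "dfb (\<lambda>\<nu> E. isf (\<nu> i) (E j))" unfolding isf_def by (intro dfb)
  qed (simp add: f_eq)
  have f_anti: "f n \<sqsubseteq> f k" if "k \<le> n" for k n using f[of k] that by (intro f_le) auto
  define T where "T = {n. \<exists>n'. n' = Suc n \<and> (\<exists>x\<in>U. x = f n \<and> (\<exists>y\<in>U. y = f n' \<and> (\<exists>z\<in>U. \<not> std z \<and> y \<oplus> z = x)))}"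
  have T: "n \<in> T \<longleftrightarrow> (\<exists>z\<in>U. \<not> std z \<and> f (Suc n) \<oplus> z = f n)" for n
    unfolding T_def using f by auto
  have "dfb (\<lambda>\<nu> E. \<nu> 0 \<in> T)" unfolding T_def mem_Collect_eq by (intro dfb)
  then have per: "eventually_periodic T" by (rule dfb_periodic)
  \<comment> \<open>Otherwise all gaps from \<open>N\<close> on are standard, and so is every drop
    from \<open>f N\<close> to a later term. But \<open>f N = y \<oplus> z\<close> with both
    summands nonstandard, and at index \<open>N + rk y\<close> the sequence is at most
    \<open>y\<close>, a drop of at least \<open>z\<close>.\<close>
  have "\<exists>n\<ge>N. n \<in> T" for N
  proof (rule ccontr)
    assume none: "\<not> (\<exists>n\<ge>N. n \<in> T)"
    have small: "\<exists>z\<in>U. std z \<and> f (Suc j) \<oplus> z = f j" if "j \<ge> N" for j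
    proof -
      obtain z where "z \<in> U" "f (Suc j) \<oplus> z = f j" using f_anti[of j "Suc j"] unfolding le_def by auto
      then show ?thesis using none that T by blast
    qed
    obtain y z where y: "y \<in> U" "z \<in> U" "\<not> std y" "\<not> std z" "f N = y \<oplus> z" using nonstd_halve f by metis
    have le: "f (N + rk y) \<sqsubseteq> y" using y by (intro f_le) auto
    obtain w where w: "w \<in> U" "std w" "f (N + rk y) \<oplus> w = f N" using sum_gap[of f N "rk y"] f small by blast
    obtain v where v: "v \<in> U" "f (N + rk y) \<oplus> v = y" using le unfolding le_def by blast
    have "f (N + rk y) \<oplus> (v \<oplus> z) = f (N + rk y) \<oplus> w" using v y w f by (metis assoc)
    then have "v \<oplus> z = w" using v y w f cancel add_closed by blast
    then have "z \<sqsubseteq> w" using v y commute le_def by blast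
    then show False using w y std_le by blast
  qed
  then have "infinite T" by (metis finite_nat_set_iff_bounded linorder_not_less)
  then obtain q r where qr: "q > 0" "\<And>n. r + q * n \<in> T" using eventually_periodic_progression[OF per] by blast
  define \<phi> where "\<phi> n = f (r + q * n)" for n
  show thesis
  proof (rule that[of \<phi> "r + q + n0"])
    show "dfb (\<lambda>\<nu> E. E j = \<phi> (\<nu> i))" for i j
    proof -
      have "dfb (\<lambda>\<nu> E. \<exists>s. s = r + q * \<nu> i \<and> E j = f s)" by (intro dfb)
      then show ?thesis by (simp add: \<phi>_def)
    qed
    show "\<phi> n \<in> U" "\<not> std (\<phi> n)" for n using f by (auto simp: \<phi>_def)
    show "rk (\<phi> n) \<le> (r + q + n0) * (n + 1)" for n
      using f(3)[of "r + q * n"] unfolding \<phi>_def by (rule order_trans) (simp add: algebra_simps)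
    show "\<exists>z\<in>U. \<not> std z \<and> \<phi> (Suc n) \<oplus> z = \<phi> n" for n
    proof -
      obtain z where z: "z \<in> U" "\<not> std z" "f (Suc (r + q * n)) \<oplus> z = f (r + q * n)" using qr(2)[of n] T by blast
      have "f (r + q * Suc n) \<sqsubseteq> f (Suc (r + q * n))" using qr(1) by (intro f_anti) simp
      then obtain w where w: "w \<in> U" "f (r + q * Suc n) \<oplus> w = f (Suc (r + q * n))" unfolding le_def by blast
      have "f (r + q * Suc n) \<oplus> (w \<oplus> z) = f (r + q * n)" using w z f by (metis assoc)
      moreover have "\<not> std (w \<oplus> z)" using z w std_le[of z "w \<oplus> z"] le_add[of z w] commute[of w z] by auto
      ultimately show ?thesis using w z add_closed unfolding \<phi>_def by blast
    qed
    show "\<exists>n. \<phi> n \<sqsubseteq> x" if "x \<in> U" "\<not> std x" for x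
      using that qr(1) unfolding \<phi>_def by (intro exI[of _ "rk x"] f_le) (auto simp: trans_le_add1 trans_le_add2)
  qed
qed

text \<open>Sums of terms of \<phi> at sufficiently separated indices are distinct, and those with
  \<open>Suc m\<close> summands provide more elements of linearly bounded rank than a ball can
  hold.\<close>

lemma all_std: "x \<in> U \<Longrightarrow> std x"
proof (rule ccontr)
  assume "x \<in> U" "\<not> std x"
  then obtain \<phi> C0 where [dfb]: "\<And>i j. dfb (\<lambda>\<nu> E. E j = \<phi> (\<nu> i))" and \<phi>: "\<And>n. \<phi> n \<in> U"
    "\<And>n. \<not> std (\<phi> n)" "\<And>n. rk (\<phi> n) \<le> C0 * (n + 1)"
    and gap: "\<And>n. \<exists>z\<in>U. \<not> std z \<and> \<phi> (Suc n) \<oplus> z = \<phi> n"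
    and coinitial: "\<And>x. x \<in> U \<Longrightarrow> \<not> std x \<Longrightarrow> \<exists>n. \<phi> n \<sqsubseteq> x"
    by (rule nonstd_sequence) blast
  have anti: "\<phi> n \<sqsubseteq> \<phi> k" if "k \<le> n" for k n
    using that
  proof (induction n rule: dec_induct)
    case (step n)
    then show ?case using gap[of n] le_trans[of "\<phi> (Suc n)" "\<phi> n" "\<phi> k"] \<phi>(1) le_def by blast
  qed (use \<phi> in simp)
  \<comment> \<open>\<open>R n i\<close> says that \<open>\<phi> i\<close> fits into the gap between
    \<open>\<phi> (Suc n)\<close> and \<open>\<phi> n\<close>; coinitiality supplies some
    \<open>i\<close>, and \<open>linear_bound\<close> one of linear size.\<close>
  define R where "R n i \<longleftrightarrow> (\<exists>n'. n' = Suc n \<and> (\<exists>x\<in>U. x = \<phi> n \<and> (\<exists>y\<in>U. y = \<phi> n' \<and>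
     (\<exists>w\<in>U. w = \<phi> i \<and> (\<exists>v\<in>U. y \<oplus> w = v \<and> v \<sqsubseteq> x)))))" for n i
  have R: "R n i \<longleftrightarrow> \<phi> (Suc n) \<oplus> \<phi> i \<sqsubseteq> \<phi> n" for n i
    unfolding R_def using \<phi>(1) by auto
  have "dfb (\<lambda>\<nu> E. R (\<nu> i) (\<nu> j))" for i j unfolding R_def by (intro dfb)
  moreover have "\<exists>i. R n i" for n
  proof -
    obtain z where z: "z \<in> U" "\<not> std z" "\<phi> (Suc n) \<oplus> z = \<phi> n" using gap by blast
    then obtain i where "\<phi> i \<sqsubseteq> z" using coinitial by blast
    then show ?thesis unfolding R using add_le_mono[of "\<phi> (Suc n)" "\<phi> i" z] z \<phi>(1) by auto
  qed
  ultimately obtain K where K: "K \<ge> 1" "\<And>n. \<exists>i\<le>K * (n + 1). R n i" by (rule linear_bound) blast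
  have sep: "\<phi> (Suc j) \<oplus> \<phi> i \<sqsubseteq> \<phi> j" if "K * (j + 1) \<le> i" for i j
  proof -
    obtain i' where i': "i' \<le> K * (j + 1)" "\<phi> (Suc j) \<oplus> \<phi> i' \<sqsubseteq> \<phi> j" using K(2) R by blast
    then have "\<phi> i \<sqsubseteq> \<phi> i'" using that by (intro anti) simp
    then have "\<phi> (Suc j) \<oplus> \<phi> i \<sqsubseteq> \<phi> (Suc j) \<oplus> \<phi> i'" using \<phi> add_le_mono by blast
    then show ?thesis using le_trans \<phi> i' by (meson add_closed)
  qed
  \<comment> \<open>This relation makes \<open>linear_bound\<close> yield linear growth of the rank
    of sums.\<close>
  define R1 where "R1 n k \<longleftrightarrow> (\<forall>x\<in>U. \<forall>y\<in>U. rk x \<le> n \<and> rk y \<le> n \<longrightarrow> (\<exists>z\<in>U. x \<oplus> y = z \<and> rk z \<le> k))" for n k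
  have "dfb (\<lambda>\<nu> E. R1 (\<nu> i) (\<nu> j))" for i j unfolding R1_def by (intro dfb)
  moreover have "\<exists>k. R1 n k" for n
  proof -
    let ?B = "{x \<in> U. rk x \<le> n}"
    have "finite ((\<lambda>(x, y). rk (x \<oplus> y)) ` (?B \<times> ?B))" using finite_ball by (intro finite_imageI finite_cartesian_product)
    then have "rk (x \<oplus> y) \<le> Max ((\<lambda>(x, y). rk (x \<oplus> y)) ` (?B \<times> ?B))" if "x \<in> ?B" "y \<in> ?B" for x y
      using that by (intro Max_ge) auto
    then show ?thesis unfolding R1_def by (intro exI[of _ "Max ((\<lambda>(x, y). rk (x \<oplus> y)) ` (?B \<times> ?B))"]) auto
  qed
  ultimately obtain K1 where K1: "\<And>n. \<exists>i\<le>K1 * (n + 1). R1 n i" by (rule linear_bound) blast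
  have rk_add: "rk (x \<oplus> y) \<le> K1 * (n + 1)" if "x \<in> U" "y \<in> U" "rk x \<le> n" "rk y \<le> n" for x y n
    using K1[of n] that unfolding R1_def by (metis order_trans)
  \<comment> \<open>Each induction step adds one summand. The sums
    \<open>\<phi> (Suc j) \<oplus> x\<close> with \<open>n \<le> j \<le> 2 * n\<close> and
    \<open>x\<close> from the family below \<open>\<phi> n'\<close> lie in disjoint intervals, from
    \<open>\<phi> (Suc j)\<close> up to but excluding \<open>\<phi> j\<close>, which multiplies the
    count by \<open>n + 1\<close>.\<close>
  have many: "\<exists>C. \<forall>n. \<exists>X. X \<subseteq> U \<and> finite X \<and> (n + 1) ^ k \<le> card X \<and> (\<forall>x\<in>X. rk x \<le> C * (n + 1) \<and> x \<sqsubset> \<phi> n)" for k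
  proof (induction k)
    case 0
    have "zero \<sqsubset> \<phi> n" for n using \<phi> std_zero unfolding lt_def by (metis zero_le)
    then show ?case by (intro exI[of _ "rk zero"] allI exI[of _ "{zero}"]) auto
  next
    case (Suc k)
    then obtain C where C: "\<And>n. \<exists>X. X \<subseteq> U \<and> finite X \<and> (n + 1) ^ k \<le> card X \<and> (\<forall>x\<in>X. rk x \<le> C * (n + 1) \<and> x \<sqsubset> \<phi> n)"
      by blast
    \<comment> \<open>Chosen so that \<open>D * (n + 1)\<close> bounds the ranks of both summands,
      \<open>C0 * (2 * n + 2)\<close> and \<open>C * (n' + 1)\<close>.\<close>
    define D where "D = 2 * C0 + 2 * K * C + C"
    show ?case
    proof (intro exI[of _ "K1 * (D + 1)"] allI)
      fix n
      \<comment> \<open>This is \<open>K * (j + 1)\<close> at the largest index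
        \<open>j = 2 * n\<close>, so \<open>sep\<close> applies with \<open>\<phi> n'\<close> to all
        \<open>j\<close> in \<open>J\<close>.\<close>
      define n' where "n' = K * (2 * n + 1)"
      have nn': "n \<le> n'" using K(1) unfolding n'_def by (metis add_lessD1 less_or_eq_imp_le mult_2 mult_le_mono nat_mult_1 trans_le_add1 le_add1 add.assoc)
      obtain X where X: "X \<subseteq> U" "finite X" "(n' + 1) ^ k \<le> card X" "\<And>x. x \<in> X \<Longrightarrow> rk x \<le> C * (n' + 1)" "\<And>x. x \<in> X \<Longrightarrow> x \<sqsubset> \<phi> n'"
        using C[of n'] by blast
      have XU: "x \<in> U" if "x \<in> X" for x using X that by blast
      define g where "g = (\<lambda>(j, x). \<phi> (Suc j) \<oplus> x)"
      define J where "J = {n..2 * n}"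
      have below: "\<phi> (Suc j) \<oplus> x \<sqsubset> \<phi> j" if "j \<in> J" "x \<in> X" for j x
      proof -
        have "\<phi> (Suc j) \<oplus> x \<sqsubset> \<phi> (Suc j) \<oplus> \<phi> n'" using X(5) XU that \<phi> by (intro add_lt_mono)
        moreover have "\<phi> (Suc j) \<oplus> \<phi> n' \<sqsubseteq> \<phi> j" using that(1) unfolding J_def n'_def by (intro sep mult_le_mono2) simp
        ultimately show ?thesis using \<phi> XU that by (meson add_closed lt_le_trans)
      qed
      have neq: "\<phi> (Suc j) \<oplus> x \<noteq> \<phi> (Suc j') \<oplus> x'" if "j \<in> J" "j' \<in> J" "x \<in> X" "x' \<in> X" "j < j'" for j j' x x'
      proof
        assume eq: "\<phi> (Suc j) \<oplus> x = \<phi> (Suc j') \<oplus> x'"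
        have "\<phi> (Suc j') \<oplus> x' \<sqsubset> \<phi> j'" using below that by blast
        moreover have "\<phi> j' \<sqsubseteq> \<phi> (Suc j)" using that by (intro anti) simp
        moreover have "\<phi> (Suc j) \<sqsubseteq> \<phi> (Suc j) \<oplus> x" using le_add \<phi> XU that by blast
        ultimately have "\<phi> (Suc j') \<oplus> x' \<sqsubset> \<phi> (Suc j) \<oplus> x" using \<phi> XU that by (meson add_closed lt_le_trans)
        then show False unfolding eq lt_def by blast
      qed
      have "inj_on g (J \<times> X)"
      proof (rule inj_onI)
        fix p p' assume p: "p \<in> J \<times> X" "p' \<in> J \<times> X" and eq: "g p = g p'"
        obtain j x j' x' where pp: "p = (j, x)" "p' = (j', x')" by fastforce
        have "j = j'" using eq neq[of j j' x x'] neq[of j' j x' x] p unfolding pp g_def by (cases j j' rule: linorder_cases) auto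
        moreover have "x = x'" using eq p calculation cancel[of "\<phi> (Suc j)" x x'] \<phi> XU unfolding pp g_def by auto
        ultimately show "p = p'" unfolding pp by simp
      qed
      then have "card (g ` (J \<times> X)) = (n + 1) * card X" by (simp add: card_image card_cartesian_product J_def)
      moreover have "(n + 1) ^ k \<le> card X" using X(3) power_mono[of "n + 1" "n' + 1" k] nn' by simp
      ultimately have card: "(n + 1) ^ Suc k \<le> card (g ` (J \<times> X))" by (simp del: add_Suc_right)
      have "rk (\<phi> (Suc j) \<oplus> x) \<le> K1 * (D + 1) * (n + 1) \<and> \<phi> (Suc j) \<oplus> x \<sqsubset> \<phi> n" if jx: "j \<in> J" "x \<in> X" for j x
      proof
        have "rk (\<phi> (Suc j)) \<le> C0 * (2 * n + 2)" using jx
          by (intro order_trans[OF \<phi>(3) mult_le_mono2]) (auto simp: J_def)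
        also have "\<dots> \<le> D * (n + 1)" unfolding D_def by (simp add: algebra_simps)
        finally have 1: "rk (\<phi> (Suc j)) \<le> D * (n + 1)" .
        have "rk x \<le> C * (n' + 1)" using X jx by blast
        also have "\<dots> \<le> D * (n + 1)" unfolding D_def n'_def by (simp add: algebra_simps)
        finally have "rk (\<phi> (Suc j) \<oplus> x) \<le> K1 * (D * (n + 1) + 1)" using 1 \<phi> XU jx by (intro rk_add)
        also have "\<dots> \<le> K1 * ((D + 1) * (n + 1))" by (intro mult_le_mono2) (simp add: algebra_simps)
        finally show "rk (\<phi> (Suc j) \<oplus> x) \<le> K1 * (D + 1) * (n + 1)" by (simp only: mult.assoc)
        show "\<phi> (Suc j) \<oplus> x \<sqsubset> \<phi> n"
          using below[OF jx] anti[of n j] jx \<phi> XU unfolding J_def by (meson add_closed lt_le_trans atLeastAtMost_iff)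
      qed
      then show "\<exists>X. X \<subseteq> U \<and> finite X \<and> (n + 1) ^ Suc k \<le> card X \<and> (\<forall>x\<in>X. rk x \<le> K1 * (D + 1) * (n + 1) \<and> x \<sqsubset> \<phi> n)"
        using card X(2) XU \<phi> by (intro exI[of _ "g ` (J \<times> X)"]) (auto simp: g_def J_def)
    qed
  qed
  obtain C where C: "\<forall>n. \<exists>X. X \<subseteq> U \<and> finite X \<and> (n + 1) ^ Suc m \<le> card X \<and> (\<forall>x\<in>X. rk x \<le> C * (n + 1) \<and> x \<sqsubset> \<phi> n)"
    using many[of "Suc m"] ..
  \<comment> \<open>For this \<open>n\<close> the constant factor \<open>(C + 1) ^ m\<close> in the
    bound on the ball is \<open>n\<close>, less than the extra factor \<open>n + 1\<close> of the
    lower bound.\<close>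
  define n where "n = (C + 1) ^ m"
  obtain X where X: "X \<subseteq> U" "finite X" "(n + 1) ^ Suc m \<le> card X" "\<And>x. x \<in> X \<Longrightarrow> rk x \<le> C * (n + 1)"
    using spec[OF C, of n] by blast
  have "(n + 1) ^ Suc m \<le> card {x \<in> U. rk x \<le> C * (n + 1)}"
    using X card_mono[OF finite_ball, of X "C * (n + 1)"] by fastforce
  also have "\<dots> \<le> (C * (n + 1) + 1) ^ m" by (rule card_ball)
  also have "\<dots> \<le> ((C + 1) * (n + 1)) ^ m" by (intro power_mono) auto
  also have "\<dots> = n * (n + 1) ^ m" unfolding power_mult_distrib by (simp add: n_def)
  finally show False by simp
qed

section \<open>Counting predecessors as an isomorphism onto the natural numbers\<close>

definition h :: "'a \<Rightarrow> nat" where "h x = card {y \<in> U. y \<sqsubset> x}"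

lemma finite_below: "x \<in> U \<Longrightarrow> finite {y \<in> U. y \<sqsubset> x}"
  using all_std[of x] unfolding std_def lt_def by (rule finite_subset[rotated]) auto

lemma h_less:
  assumes "x \<in> U" "y \<in> U" "x \<sqsubset> y"
  shows "h x < h y"
proof -
  have "{z \<in> U. z \<sqsubset> x} \<subset> {z \<in> U. z \<sqsubset> y}"
    using assms lt_le_trans[of _ x y] unfolding lt_def by blast
  then show ?thesis unfolding h_def using finite_below assms by (intro psubset_card_mono)
qed

lemma h_less_iff: "x \<in> U \<Longrightarrow> y \<in> U \<Longrightarrow> h x < h y \<longleftrightarrow> x \<sqsubset> y"
  by (metis h_less less_asym less_irrefl lt_def not_le)

lemma h_le_iff: "x \<in> U \<Longrightarrow> y \<in> U \<Longrightarrow> h x \<le> h y \<longleftrightarrow> x \<sqsubseteq> y"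
  using h_less_iff not_le linorder_not_less by metis

lemma h_eq_iff: "x \<in> U \<Longrightarrow> y \<in> U \<Longrightarrow> h x = h y \<longleftrightarrow> x = y"
  using h_less_iff not_le by (metis less_irrefl lt_def)

lemma h_zero [simp]: "h zero = 0"
proof -
  have "{y \<in> U. y \<sqsubset> zero} = {}" unfolding lt_def using le_antisym by force
  then show ?thesis unfolding h_def by (simp only: card.empty)
qed

lemma h_Suc: "x \<in> U \<Longrightarrow> h (x \<oplus> one) = Suc (h x)"
proof -
  assume x: "x \<in> U"
  have "{y \<in> U. y \<sqsubset> x \<oplus> one} = insert x {y \<in> U. y \<sqsubset> x}"
    using lt_add_one_iff[OF x] le_refl[OF x] x lt_def by blast
  then show ?thesis unfolding h_def using finite_below[OF x] by (simp add: lt_def)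
qed

lemma h_surj: "\<exists>x\<in>U. h x = n"
proof (induction n)
  case 0
  then show ?case by (intro bexI[of _ zero]) auto
next
  case (Suc n)
  then show ?case using h_Suc add_closed one_closed by metis
qed

lemma h_add: "x \<in> U \<Longrightarrow> y \<in> U \<Longrightarrow> h (x \<oplus> y) = h x + h y"
proof (induction "h y" arbitrary: y)
  case 0
  then have "y = zero" using h_eq_iff[of y zero] by simp
  then show ?case using 0 by simp
next
  case (Suc n)
  then have "y \<noteq> zero" by auto
  then obtain z where z: "z \<in> U" "y = z \<oplus> one" using pred Suc by blast
  then have "h (x \<oplus> z) = h x + h z" using Suc h_Suc by (intro Suc.hyps) auto
  moreover have "x \<oplus> y = (x \<oplus> z) \<oplus> one" using z Suc assoc by auto
  ultimately show ?case using z Suc h_Suc by auto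
qed

lemma bij_h: "bij_betw h U UNIV"
  unfolding bij_betw_def inj_on_def using h_eq_iff h_surj by (metis (no_types, lifting) UNIV_eq_I image_eqI)

section \<open>Definable functions from numbers to the model\<close>

definition elt :: "nat \<Rightarrow> 'a" where "elt n = (SOME x. x \<in> U \<and> h x = n)"

lemma elt [simp]: "elt n \<in> U" "h (elt n) = n"
proof -
  have "elt n \<in> U \<and> h (elt n) = n"
    unfolding elt_def by (rule someI_ex) (use h_surj in blast)
  then show "elt n \<in> U" "h (elt n) = n" by auto
qed

lemma elt_eq_iff: "x \<in> U \<Longrightarrow> h x = n \<longleftrightarrow> x = elt n"
  using h_eq_iff[of x "elt n"] by auto

lemma ex_elt: "(\<exists>x\<in>U. h x = n \<and> P x) \<longleftrightarrow> P (elt n)"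
  using elt_eq_iff by auto

text \<open>Zero is the only idempotent, and each further constant is the immediate successor of the
  previous one in the order of the model.\<close>

lemma dfb_h_const: "dfb (\<lambda>\<nu> E. h (E i) = c)"
proof (induction c arbitrary: i)
  case 0
  have "dfb (\<lambda>\<nu> E. E i \<oplus> E i = E i)" by (rule dfb_addE)
  then show ?case by (rule dfb_cong[rotated]) (use h_add in \<open>metis add_zero cancel elt_eq_iff h_zero zero_closed\<close>)
next
  case (Suc c)
  have "dfb (\<lambda>\<nu> E. \<exists>x\<in>U. h x = c \<and> x \<sqsubset> E i \<and> (\<forall>y\<in>U. x \<sqsubset> y \<longrightarrow> E i \<sqsubseteq> y))"
    by (intro dfb Suc.IH)
  then show ?case
  proof (rule dfb_cong[rotated])
    fix \<nu> and E :: "nat \<Rightarrow> 'a" assume E: "\<And>i. E i \<in> U"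
    have "(\<forall>y\<in>U. elt c \<sqsubset> y \<longrightarrow> E i \<sqsubseteq> y) \<longleftrightarrow> h (E i) \<le> Suc c"
    proof
      assume "\<forall>y\<in>U. elt c \<sqsubset> y \<longrightarrow> E i \<sqsubseteq> y"
      then have "E i \<sqsubseteq> elt (Suc c)" by (simp flip: h_less_iff)
      then show "h (E i) \<le> Suc c" using E by (simp flip: h_le_iff)
    next
      assume "h (E i) \<le> Suc c"
      then show "\<forall>y\<in>U. elt c \<sqsubset> y \<longrightarrow> E i \<sqsubseteq> y" using E by (auto simp flip: h_le_iff h_less_iff)
    qed
    then show "(\<exists>x\<in>U. h x = c \<and> x \<sqsubset> E i \<and> (\<forall>y\<in>U. x \<sqsubset> y \<longrightarrow> E i \<sqsubseteq> y)) = (h (E i) = Suc c)"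
      unfolding ex_elt using E h_less_iff[of "elt c" "E i"] by auto
  qed
qed

text \<open>The argument is a number of (\<nat>, +), whereas the value is read as an element of the
  model through \<open>h\<close>. As definability of \<open>h\<close> is still open, this is not
  definability of \<open>f\<close> as a function on numbers.\<close>

definition dfun :: "(nat \<Rightarrow> nat) \<Rightarrow> bool" where
  "dfun f \<longleftrightarrow> (\<forall>i j. dfb (\<lambda>\<nu> E. h (E j) = f (\<nu> i)))"

lemma dfun_dfb: "dfun f \<Longrightarrow> dfb (\<lambda>\<nu> E. h (E j) = f (\<nu> i))"
  unfolding dfun_def by blast

lemma dfun_running_max:
  assumes "dfun f"
  shows "dfun (\<lambda>n. Max (f ` {..n}))"
  unfolding dfun_def
proof (intro allI)
  fix i j
  note [dfb] = dfun_dfb[OF assms]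
  have "dfb (\<lambda>\<nu> E. (\<exists>k. k \<le> \<nu> i \<and> h (E j) = f k) \<and> (\<forall>k. k \<le> \<nu> i \<longrightarrow> (\<exists>x\<in>U. h x = f k \<and> x \<sqsubseteq> E j)))"
    by (intro dfb)
  then show "dfb (\<lambda>\<nu> E. h (E j) = Max (f ` {..\<nu> i}))"
  proof (rule dfb_cong[rotated])
    fix \<nu> :: "nat \<Rightarrow> nat" and E :: "nat \<Rightarrow> 'a" assume E: "\<And>i. E i \<in> U"
    have le: "elt k \<sqsubseteq> E j \<longleftrightarrow> k \<le> h (E j)" for k using E h_le_iff[of "elt k" "E j"] by simp
    have "h (E j) = Max (f ` {..\<nu> i}) \<longleftrightarrow> h (E j) \<in> f ` {..\<nu> i} \<and> (\<forall>a\<in>f ` {..\<nu> i}. a \<le> h (E j))"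
      using Max_eq_iff[of "f ` {..\<nu> i}" "h (E j)"] by auto
    then show "((\<exists>k. k \<le> \<nu> i \<and> h (E j) = f k) \<and> (\<forall>k. k \<le> \<nu> i \<longrightarrow> (\<exists>x\<in>U. h x = f k \<and> x \<sqsubseteq> E j))) =
      (h (E j) = Max (f ` {..\<nu> i}))" unfolding ex_elt le by auto
  qed
qed

text \<open>The difference is the solution of an equation in the model; monotonicity makes the
  truncated subtraction exact.\<close>

lemma dfun_diff:
  assumes "dfun f" "mono f"
  shows "dfun (\<lambda>n. f (Suc n) - f n)"
  unfolding dfun_def
proof (intro allI)
  fix i j
  note [dfb] = dfun_dfb[OF assms(1)]
  have "dfb (\<lambda>\<nu> E. \<exists>k. k = Suc (\<nu> i) \<and> (\<exists>x\<in>U. h x = f (\<nu> i) \<and> (\<exists>y\<in>U. h y = f k \<and> x \<oplus> E j = y)))"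
    by (intro dfb)
  then show "dfb (\<lambda>\<nu> E. h (E j) = f (Suc (\<nu> i)) - f (\<nu> i))"
  proof (rule dfb_cong[rotated])
    fix \<nu> :: "nat \<Rightarrow> nat" and E :: "nat \<Rightarrow> 'a" assume E: "\<And>i. E i \<in> U"
    have "f (\<nu> i) \<le> f (Suc (\<nu> i))" using assms(2) by (simp add: monoD)
    then show "(\<exists>k. k = Suc (\<nu> i) \<and> (\<exists>x\<in>U. h x = f (\<nu> i) \<and> (\<exists>y\<in>U. h y = f k \<and> x \<oplus> E j = y))) =
      (h (E j) = f (Suc (\<nu> i)) - f (\<nu> i))"
      unfolding ex_elt using E h_add[of "elt (f (\<nu> i))" "E j"] elt_eq_iff[of "elt (f (\<nu> i)) \<oplus> E j" "f (Suc (\<nu> i))"]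
      by auto
  qed
qed

lemma dfb_ex_less: "(\<And>t. t < (n::nat) \<Longrightarrow> dfb (P t)) \<Longrightarrow> dfb (\<lambda>\<nu> E. \<exists>t<n. P t \<nu> E)"
proof (induction n)
  case 0
  have "dfb (\<lambda>\<nu> E. \<not> E 0 = E 0)" by (intro dfb)
  then show ?case by simp
next
  case (Suc n)
  have 1: "dfb (\<lambda>\<nu> E. \<exists>t<n. P t \<nu> E)" by (rule Suc.IH) (rule Suc.prems, simp)
  have 2: "dfb (P n)" by (rule Suc.prems) simp
  show ?case using dfb_disj[OF 2 1] by (simp add: Ex_less_Suc)
qed

text \<open>Finitely many level sets determine \<open>g\<close>, and the product of their periods is
  a period of all of them.\<close>

lemma ex_common_period:
  assumes "\<And>b. eventually_periodic {n. g n = b}" "\<And>n. g n < (B :: nat)"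
  obtains q N where "q > 0" "\<And>n. n \<ge> N \<Longrightarrow> g (n + q) = g n"
proof -
  have "\<exists>q>0. \<exists>N. \<forall>b<B. \<forall>n\<ge>N. g (n + q) = b \<longleftrightarrow> g n = b" for B
  proof (induction B)
    case 0
    then show ?case by auto
  next
    case (Suc B)
    then obtain q N where q: "q > 0" "\<And>b n. b < B \<Longrightarrow> n \<ge> N \<Longrightarrow> g (n + q) = b \<longleftrightarrow> g n = b" by blast
    obtain q' N' where q': "q' > 0" "\<And>n. n \<ge> N' \<Longrightarrow> g (n + q') = B \<longleftrightarrow> g n = B"
      using assms(1)[of B] unfolding eventually_periodic_def by auto
    have 1: "g (n + q * k) = b \<longleftrightarrow> g n = b" if "b < B" "n \<ge> N" for b n k
      by (induction k) (use that q(2)[of b "n + q * _"] in \<open>auto simp: algebra_simps\<close>)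
    have 2: "g (n + q' * k) = B \<longleftrightarrow> g n = B" if "n \<ge> N'" for n k
      by (induction k) (use that q'(2)[of "n + q' * _"] in \<open>auto simp: algebra_simps\<close>)
    have "\<forall>b<Suc B. \<forall>n\<ge>max N N'. g (n + q * q') = b \<longleftrightarrow> g n = b"
    proof (intro allI impI)
      fix b n assume "b < Suc B" "n \<ge> max N N'"
      then show "g (n + q * q') = b \<longleftrightarrow> g n = b"
        using 1[of b n q'] 2[of n q] by (cases "b = B") (auto simp: mult.commute)
    qed
    moreover have "q * q' > 0" using q q' by simp
    ultimately show ?case by blast
  qed
  then obtain q N where "q > 0" "\<forall>b<B. \<forall>n\<ge>N. g (n + q) = b \<longleftrightarrow> g n = b" by blast
  then show thesis using that assms(2) by metis
qed

lemma dfun_level_periodic: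
  assumes "dfun g"
  shows "eventually_periodic {n. g n = b}"
proof (rule dfb_periodic)
  note [dfb] = dfun_dfb[OF assms]
  have "dfb (\<lambda>\<nu> E. \<exists>x\<in>U. h x = b \<and> h x = g (\<nu> 0))" by (intro dfb dfb_h_const)
  then show "dfb (\<lambda>\<nu> E. \<nu> 0 \<in> {n. g n = b})" unfolding ex_elt by (simp add: eq_commute)
qed

section \<open>Growth of definable functions and definability of the isomorphism\<close>

definition graph_dfb :: bool where "graph_dfb \<longleftrightarrow> dfb (\<lambda>\<nu> E. \<nu> 0 = h (E 0))"

text \<open>Division with remainder by \<alpha>: a number is \<open>t + \<alpha> * j\<close> with
  \<open>t < \<alpha>\<close>. The multiple \<open>\<alpha> * j\<close> is carried into the model as
  the difference of \<open>f (n0 + q * j)\<close> and \<open>f n0\<close>, and each constant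
  \<open>t\<close> is definable on its own.\<close>

lemma graph_of_linear:
  assumes "dfun f" "\<alpha> > 0" and f: "\<And>j. f (n0 + q * j) = f n0 + \<alpha> * j"
  shows graph_dfb
proof -
  note [dfb] = dfun_dfb[OF assms(1)] dfb_h_const
  define P where "P = (\<lambda>t (\<nu> :: nat \<Rightarrow> nat) (E :: nat \<Rightarrow> 'a). \<exists>j. \<nu> 0 = t + \<alpha> * j \<and> (\<exists>s. s = n0 + q * j \<and>
    (\<exists>x\<in>U. h x = f s \<and> (\<exists>y\<in>U. h y = t \<and> (\<exists>w\<in>U. h w = f n0 \<and> (\<exists>z\<in>U. x \<oplus> y = z \<and> E 0 \<oplus> w = z))))))"
  have "dfb (P t)" for t unfolding P_def by (intro dfb)
  then have "dfb (\<lambda>\<nu> E. \<exists>t<\<alpha>. P t \<nu> E)" by (rule dfb_ex_less)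
  then show ?thesis unfolding graph_dfb_def
  proof (rule dfb_cong[rotated])
    fix \<nu> :: "nat \<Rightarrow> nat" and E :: "nat \<Rightarrow> 'a" assume E: "\<And>i. E i \<in> U"
    have P: "P t \<nu> E \<longleftrightarrow> (\<exists>j. \<nu> 0 = t + \<alpha> * j \<and> h (E 0) = t + \<alpha> * j)" for t
    proof -
      have "E 0 \<oplus> elt (f n0) = elt (f n0 + \<alpha> * j) \<oplus> elt t \<longleftrightarrow> h (E 0) = t + \<alpha> * j" for j
        using E h_add[of "E 0" "elt (f n0)"] h_add[of "elt (f n0 + \<alpha> * j)" "elt t"]
          h_eq_iff[of "E 0 \<oplus> elt (f n0)" "elt (f n0 + \<alpha> * j) \<oplus> elt t"] by auto
      then show ?thesis unfolding P_def ex_elt by (auto simp: ex_elt f)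
    qed
    show "(\<exists>t<\<alpha>. P t \<nu> E) = (\<nu> 0 = h (E 0))"
    proof
      assume "\<nu> 0 = h (E 0)"
      then have "P (h (E 0) mod \<alpha>) \<nu> E" unfolding P by (intro exI[of _ "h (E 0) div \<alpha>"]) simp
      then show "\<exists>t<\<alpha>. P t \<nu> E" using assms(2) by (meson mod_less_divisor)
    qed (auto simp: P)
  qed
qed

text \<open>Induction on the degree; degree 0 contradicts unboundedness. The differences
  \<open>g\<close> of the running maximum \<open>F\<close> are again definable. If bounded, they are
  eventually periodic and \<open>F\<close> is linear along a progression; otherwise their growth has
  degree \<open>k\<close> and the induction hypothesis applies to them.\<close>

lemma graph_of_polynomial_growth:
  assumes "dfun f" "\<And>b. \<exists>n. f n > b" "\<And>n. f n \<le> c * (n + 1) ^ k"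
  shows graph_dfb
  using assms
proof (induction k arbitrary: f c)
  case 0
  then show ?case by (metis mult.right_neutral not_less power_0)
next
  case (Suc k)
  define F where "F n = Max (f ` {..n})" for n
  have F: "dfun F" using dfun_running_max[OF Suc.prems(1)] unfolding F_def .
  have mono: "mono F" unfolding F_def by (intro monoI Max_mono) auto
  have F_unb: "\<exists>n. F n > b" for b
  proof -
    obtain n where "f n > b" using Suc.prems(2) by blast
    moreover have "f n \<le> F n" unfolding F_def by (intro Max_ge) auto
    ultimately show ?thesis using less_le_trans by blast
  qed
  have F_le: "F n \<le> c * (n + 1) ^ Suc k" for n
  proof -
    have "f i \<le> c * (n + 1) ^ Suc k" if "i \<le> n" for i
      by (rule order_trans[OF Suc.prems(3)]) (intro mult_le_mono2 power_mono; use that in simp)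
    then show ?thesis unfolding F_def by (subst Max_le_iff) auto
  qed
  define g where "g n = F (Suc n) - F n" for n
  have g: "dfun g" using dfun_diff[OF F mono] unfolding g_def .
  have F_Suc: "F (Suc n) = F n + g n" for n using mono unfolding g_def by (simp add: monoD)
  show ?case
  proof (cases "\<exists>B. \<forall>n. g n < B")
    case True
    then obtain B where "\<And>n. g n < B" by blast
    then obtain q N where q: "q > 0" "\<And>n. n \<ge> N \<Longrightarrow> g (n + q) = g n"
      using ex_common_period dfun_level_periodic[OF g] by metis
    \<comment> \<open>The increase of \<open>F\<close> over one period; it is positive because
      \<open>F\<close> is unbounded.\<close>
    define \<alpha> where "\<alpha> = F (N + q) - F N"
    have step: "F (n + q) = F n + \<alpha>" if "n \<ge> N" for n
      using that
    proof (induction n rule: dec_induct)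
      case base
      show ?case using mono unfolding \<alpha>_def by (simp add: monoD)
    next
      case (step n)
      then show ?case using F_Suc[of "n + q"] F_Suc[of n] q(2)[of n] by simp
    qed
    have lin: "F (N + q * j) = F N + \<alpha> * j" for j
      by (induction j) (use step[of "N + q * _"] in \<open>auto simp: algebra_simps\<close>)
    have "\<alpha> > 0"
    proof (rule ccontr)
      assume "\<not> \<alpha> > 0"
      then have const: "F (N + q * j) = F N" for j using lin by simp
      obtain n where "F n > F N" using F_unb by blast
      also have "F n \<le> F (N + q * n)" using mono q(1) by (intro monoD[OF mono]) (simp add: trans_le_add2)
      finally show False using const by simp
    qed
    then show ?thesis using graph_of_linear[OF F _ lin] by blast
  next
    case False
    then have g_unb: "\<exists>n. g n > b" for b by (metis Suc_le_eq less_Suc_eq_le not_less)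
    \<comment> \<open>The record indices of \<open>g\<close>, where it exceeds all earlier values.
      There are infinitely many since \<open>g\<close> is unbounded, so a whole progression consists
      of records.\<close>
    define S where "S = {i. \<forall>j. j < i \<longrightarrow> (\<exists>x\<in>U. h x = g j \<and> (\<exists>y\<in>U. h y = g i \<and> x \<sqsubset> y))}"
    have S: "i \<in> S \<longleftrightarrow> (\<forall>j<i. g j < g i)" for i
      unfolding S_def using h_less_iff[OF elt(1) elt(1)] by (simp add: ex_elt)
    note [dfb] = dfun_dfb[OF g]
    have "dfb (\<lambda>\<nu> E. \<nu> 0 \<in> S)" unfolding S_def mem_Collect_eq by (intro dfb)
    then have "eventually_periodic S" by (rule dfb_periodic)
    moreover have "infinite S"
    proof -
      have "\<exists>i\<ge>N. i \<in> S" for N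
      proof -
        obtain n where "g n > Max (g ` {..N})" using g_unb by blast
        define i where "i = (LEAST n. g n > Max (g ` {..N}))"
        have i: "g i > Max (g ` {..N})" unfolding i_def using \<open>g n > _\<close> by (rule LeastI)
        have lo: "g j \<le> Max (g ` {..N})" if "j < i" for j using not_less_Least[OF that[unfolded i_def]] by (simp only: not_less)
        have "i \<in> S" unfolding S using lo i by (meson le_less_trans)
        moreover have "\<not> i \<le> N" using i Max_ge[of "g ` {..N}" "g i"] by fastforce
        ultimately show ?thesis by (metis nat_le_linear)
      qed
      then show ?thesis by (metis finite_nat_set_iff_bounded linorder_not_less)
    qed
    ultimately obtain q r where qr: "q > 0" "\<And>n. r + q * n \<in> S" by (rule eventually_periodic_progression) blast
    have rec: "g i \<le> g (r + q * n)" if "i \<le> r + q * n" for i n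
      using that qr(2)[of n] unfolding S by (cases "i = r + q * n") (auto intro: less_imp_le)
    \<comment> \<open>From \<open>r + q * n\<close> on, every index of the progression adds at least
      the record value \<open>g (r + q * n)\<close> to \<open>F\<close>.\<close>
    have sum: "j * g (r + q * n) \<le> F (r + q * (n + j))" for n j
    proof (induction j)
      case (Suc j)
      have "g (r + q * n) \<le> g (r + q * (n + j))" by (intro rec) simp
      moreover have "F (Suc (r + q * (n + j))) \<le> F (r + q * (n + Suc j))"
        using qr(1) by (intro monoD[OF mono]) simp
      ultimately show ?case using Suc F_Suc[of "r + q * (n + j)"] by simp
    qed simp
    \<comment> \<open>With \<open>n + 1\<close> such summands, \<open>(n + 1) * g n\<close> is at
      most a value of \<open>F\<close> at an index linear in \<open>n\<close>; cancelling
      \<open>n + 1\<close> lowers the degree by one.\<close>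
    define c' where "c' = c * (r + 2 * q + 1) ^ Suc k"
    have "g n \<le> c' * (n + 1) ^ k" for n
    proof -
      have "(n + 1) * g n \<le> (n + 1) * g (r + q * n)" using qr(1) by (intro mult_le_mono2 rec) (simp add: trans_le_add2)
      also have "\<dots> \<le> F (r + q * (n + (n + 1)))" by (rule sum)
      also have "\<dots> \<le> c * (r + q * (n + (n + 1)) + 1) ^ Suc k" by (rule F_le)
      also have "\<dots> \<le> c * ((r + 2 * q + 1) * (n + 1)) ^ Suc k"
        by (intro mult_le_mono2 power_mono) (auto simp: algebra_simps)
      also have "\<dots> = (n + 1) * (c' * (n + 1) ^ k)" unfolding c'_def power_mult_distrib by (simp add: algebra_simps)
      finally show ?thesis by (simp only: Suc_eq_plus1[symmetric] Suc_mult_le_cancel1)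
    qed
    then show ?thesis using Suc.IH[OF g g_unb] by blast
  qed
qed

text \<open>The least element of rank above \<open>n\<close>, as a function \<open>f\<close> of
  \<open>n\<close>, is definable. All elements below it lie in the ball of radius \<open>n\<close>,
  so \<open>f n \<le> (n + 1) ^ m\<close>; it is unbounded because every initial segment has bounded
  rank.\<close>

lemma graph_definable: "dfb (\<lambda>\<nu> E. \<nu> 0 = h (E 0))"
proof -
  define f where "f n = (LEAST y. rk (elt y) > n)" for n
  have ex: "\<exists>y. rk (elt y) > n" for n
  proof (rule ccontr)
    assume "\<not> ?thesis"
    then have "elt ` UNIV \<subseteq> {x \<in> U. rk x \<le> n}" by (auto simp: not_less)
    then have "finite (elt ` (UNIV :: nat set))" using finite_ball finite_subset by blast
    moreover have "inj elt" by (metis elt(2) injI)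
    ultimately show False by (simp add: finite_image_iff)
  qed
  have f: "rk (elt (f n)) > n" for n unfolding f_def using ex by (rule LeastI_ex)
  have f_least: "rk (elt y) \<le> n" if "y < f n" for y n using that not_less_Least unfolding f_def by fastforce
  have "dfun f" unfolding dfun_def
  proof (intro allI)
    fix i j
    have "dfb (\<lambda>\<nu> E. \<not> rk (E j) \<le> \<nu> i \<and> (\<forall>x\<in>U. x \<sqsubset> E j \<longrightarrow> rk x \<le> \<nu> i))" by (intro dfb)
    then show "dfb (\<lambda>\<nu> E. h (E j) = f (\<nu> i))"
    proof (rule dfb_cong[rotated])
      fix \<nu> :: "nat \<Rightarrow> nat" and E :: "nat \<Rightarrow> 'a" assume E: "\<And>i. E i \<in> U"
      let ?n = "\<nu> i"
      have e: "elt (h (E j)) = E j" using E elt_eq_iff[of "E j" "h (E j)"] by metis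
      show "(\<not> rk (E j) \<le> ?n \<and> (\<forall>x\<in>U. x \<sqsubset> E j \<longrightarrow> rk x \<le> ?n)) = (h (E j) = f ?n)"
      proof
        assume *: "\<not> rk (E j) \<le> ?n \<and> (\<forall>x\<in>U. x \<sqsubset> E j \<longrightarrow> rk x \<le> ?n)"
        then have "\<not> h (E j) < f ?n" using f_least[of "h (E j)"] e by auto
        moreover have "\<not> f ?n < h (E j)" using * f[of ?n] h_less_iff[of "elt (f ?n)" "E j"] E by force
        ultimately show "h (E j) = f ?n" by simp
      next
        assume eq: "h (E j) = f ?n"
        then have ej: "E j = elt (f ?n)" using e by simp
        have "rk x \<le> ?n" if "x \<in> U" "x \<sqsubset> E j" for x
          using f_least[of "h x" ?n] h_less_iff[of x "E j"] that E eq elt_eq_iff[of x "h x"] by metis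
        then show "\<not> rk (E j) \<le> ?n \<and> (\<forall>x\<in>U. x \<sqsubset> E j \<longrightarrow> rk x \<le> ?n)" using f[of ?n] ej by auto
      qed
    qed
  qed
  moreover have "\<exists>n. f n > b" for b
  proof -
    define n where "n = Max ((\<lambda>y. rk (elt y)) ` {..b})"
    have "rk (elt y) \<le> n" if "y \<le> b" for y using that unfolding n_def by (intro Max_ge) auto
    then show ?thesis using f[of n] by (metis not_less)
  qed
  moreover have "f n \<le> 1 * (n + 1) ^ m" for n
  proof -
    have "inj_on elt {..<f n}" by (metis elt(2) inj_onI)
    moreover have "elt ` {..<f n} \<subseteq> {x \<in> U. rk x \<le> n}" using f_least by auto
    ultimately have "card {..<f n} \<le> card {x \<in> U. rk x \<le> n}" using finite_ball card_inj_on_le by blast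
    then show ?thesis using card_ball[of n] by simp
  qed
  ultimately have graph_dfb by (rule graph_of_polynomial_growth)
  then show ?thesis unfolding graph_dfb_def .
qed

end

section \<open>Interpretations in the natural numbers\<close>

text \<open>A quantifier over \<open>m\<close>-tuples is \<open>m\<close> quantifiers over numbers:
  the tuple occupies the first \<open>m\<close> positions and the old assignment is shifted by
  \<open>m\<close>. The outermost quantifier binds the last entry.\<close>

lemma definable_ex_list:
  "definable (\<lambda>e. P (\<lambda>i. e (i + m)) (map e [0..<m])) \<Longrightarrow> definable (\<lambda>e. \<exists>xs. length xs = m \<and> P e xs)"
proof (induction m arbitrary: P)
  case (Suc m)
  have "definable (\<lambda>e. \<exists>ys. length ys = m \<and> P (\<lambda>i. e (Suc i)) (ys @ [e 0]))"
    using Suc.prems by (intro Suc.IH) (simp add: add.commute)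
  then have "definable (\<lambda>e. \<exists>a. \<exists>ys. length ys = m \<and> P e (ys @ [a]))"
    by (rule definable_ex)
  moreover have "(\<exists>xs. length xs = Suc m \<and> Q xs) \<longleftrightarrow> (\<exists>a ys. length ys = m \<and> Q (ys @ [a]))" for Q :: "nat list \<Rightarrow> bool"
    by (metis length_Suc_conv_rev length_append_singleton)
  ultimately show ?case by simp
qed (simp add: fun_eq_iff)

lemma definable_in_def_set:
  assumes "fv \<phi> \<subseteq> {..<k}"
  shows "definable (\<lambda>e. map (\<lambda>j. e (s j)) [0..<k] \<in> def_set nat_plus k \<phi>)"
proof -
  have "sat nat_plus (\<lambda>i. map (\<lambda>j. e (s j)) [0..<k] ! i) \<phi> = sat nat_plus (\<lambda>i. e (s i)) \<phi>" for e
    using assms by (intro sat_cong) auto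
  then show ?thesis by (simp add: def_set_def nat_plus_def definable_sat[unfolded nat_plus_def])
qed

lemma map_append_map:
  "map f [0..<a] @ map g [0..<b] = map (\<lambda>l. if l < a then f l else g (l - a)) [0..<a + b]"
  by (rule nth_equalityI) (auto simp: nth_append)

text \<open>A formula obtained from \<open>definable\<close> may have stray free variables; as
  \<open>P\<close> does not depend on them, binding them by \<open>Ex\<close> leaves the defined
  relation unchanged.\<close>

lemma definable_closed_form:
  assumes "definable P" "\<And>e e'. (\<And>i. i \<in> A \<Longrightarrow> e i = e' i) \<Longrightarrow> P e = P e'"
  shows "\<exists>F. fv F \<subseteq> A \<and> (\<forall>e. sat nat_plus e F = P e)"
proof -
  obtain \<phi> where "\<And>e. sat nat_plus e \<phi> = P e" using assms(1) unfolding definable_def by blast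
  then show ?thesis
  proof (induction "card (fv \<phi> - A)" arbitrary: \<phi>)
    case 0
    then show ?case by (intro exI[of _ \<phi>]) auto
  next
    case (Suc n)
    then have "fv \<phi> - A \<noteq> {}" by (metis card.empty nat.distinct(1))
    then obtain i where i: "i \<in> fv \<phi>" "i \<notin> A" by blast
    have "fv (Ex i \<phi>) - A = (fv \<phi> - A) - {i}" by auto
    then have "card (fv (Ex i \<phi>) - A) = n" using Suc.hyps(2) i by simp
    moreover have "sat nat_plus e (Ex i \<phi>) = P e" for e
    proof -
      have "P (e(i := a)) = P e" for a using i by (intro assms(2)) auto
      then show ?thesis using Suc.prems by (simp add: nat_plus_def)
    qed
    ultimately show ?case using Suc.hyps(1) by metis
  qed
qed

section \<open>The internal model and the rank of its elements\<close>

locale nat_interpretation =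
  fixes \<iota> :: interp
  assumes interp: "interpretation_in nat_plus \<iota>"
begin

abbreviation "m \<equiv> dim \<iota>"
abbreviation "D \<equiv> idom nat_plus \<iota>"
abbreviation "Q \<equiv> ieq nat_plus \<iota>"
abbreviation "U \<equiv> D // Q"
abbreviation "add \<equiv> addition (internal_model nat_plus \<iota>)"

lemma equiv: "equiv D Q" and D_nonempty: "D \<noteq> {}"
  and fv_dom: "fv (dom_fm \<iota>) \<subseteq> {..<m}"
  and fv_eq: "fv (eq_fm \<iota>) \<subseteq> {..<2 * m}"
  and fv_add: "fv (add_fm \<iota>) \<subseteq> {..<3 * m}"
  using interp unfolding interpretation_in_def by blast+

lemma length_D: "x \<in> D \<Longrightarrow> length x = m"
  unfolding idom_def def_set_def by simp

lemma class_in_U: "x \<in> D \<Longrightarrow> Q `` {x} \<in> U"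
  by (rule quotientI)

lemma ex_U: "(\<exists>X\<in>U. P X) \<longleftrightarrow> (\<exists>x\<in>D. P (Q `` {x}))"
  unfolding quotient_def by auto

lemma add_iff:
  assumes "X \<in> U" "Y \<in> U" "Z \<in> U"
  shows "add X Y = Z \<longleftrightarrow> iadd nat_plus \<iota> X Y Z"
proof -
  have "\<exists>!Z. Z \<in> U \<and> iadd nat_plus \<iota> X Y Z"
    using interp assms unfolding interpretation_in_def by blast
  from theI'[OF this] this show ?thesis
    using assms(3) unfolding internal_model_def by auto
qed

text \<open>The least maximum norm among the tuples representing the class.\<close>

definition rk :: "nat list set \<Rightarrow> nat" where
  "rk X = (LEAST n. \<exists>x\<in>X. \<forall>a\<in>set x. a \<le> n)"

lemma rk_le_iff:
  assumes "X \<in> U"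
  shows "rk X \<le> n \<longleftrightarrow> (\<exists>x\<in>X. \<forall>a\<in>set x. a \<le> n)"
proof
  obtain x where "x \<in> X" using assms equiv in_quotient_imp_non_empty by blast
  moreover have "\<forall>a\<in>set x. a \<le> Max (set x)" by simp
  ultimately have "\<exists>y\<in>X. \<forall>a\<in>set y. a \<le> Max (set x)" by blast
  then have "\<exists>x\<in>X. \<forall>a\<in>set x. a \<le> rk X" unfolding rk_def by (rule LeastI[where P = "\<lambda>n. \<exists>x\<in>X. \<forall>a\<in>set x. a \<le> n"])
  then show "rk X \<le> n \<Longrightarrow> \<exists>x\<in>X. \<forall>a\<in>set x. a \<le> n" by (meson order_trans)
qed (auto simp: rk_def intro: Least_le)

text \<open>Gives finiteness and size of balls at once: there are only \<open>(n + 1) ^ m\<close>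
  candidate tuples.\<close>

lemma ball_subset: "{X \<in> U. rk X \<le> n} \<subseteq> (\<lambda>x. Q `` {x}) ` {x. set x \<subseteq> {..n} \<and> length x = m}"
proof
  fix X assume X: "X \<in> {X \<in> U. rk X \<le> n}"
  then obtain x where x: "x \<in> X" "\<forall>a\<in>set x. a \<le> n" using rk_le_iff by blast
  obtain y where y: "y \<in> D" "X = Q `` {y}" using X by (auto elim: quotientE)
  then have "(y, x) \<in> Q" using x by simp
  then have "X = Q `` {x}" "x \<in> D" using y equiv_class_eq[OF equiv] unfolding ieq_def by auto
  then show "X \<in> (\<lambda>x. Q `` {x}) ` {x. set x \<subseteq> {..n} \<and> length x = m}" using x length_D by auto
qed

lemma finite_ball: "finite {X \<in> U. rk X \<le> n}"
  using ball_subset by (rule finite_subset) (intro finite_imageI finite_lists_length_eq; simp)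

lemma card_ball: "card {X \<in> U. rk X \<le> n} \<le> (n + 1) ^ m"
proof -
  let ?L = "{x. set x \<subseteq> {..n} \<and> length x = m}"
  have fin: "finite ?L" by (intro finite_lists_length_eq) simp
  have "card {X \<in> U. rk X \<le> n} \<le> card ((\<lambda>x. Q `` {x}) ` ?L)"
    using ball_subset fin by (intro card_mono) auto
  also have "\<dots> \<le> card ?L" using fin by (rule card_image_le)
  also have "\<dots> = (n + 1) ^ m" by (simp add: card_lists_length_eq)
  finally show ?thesis .
qed

section \<open>Definability of relations between tuples and between classes\<close>

lemma definable_in_D: "definable (\<lambda>e. map (\<lambda>j. e (s j)) [0..<m] \<in> D)"
  unfolding idom_def by (rule definable_in_def_set[OF fv_dom])

lemma definable_in_Q: "definable (\<lambda>e. (map (\<lambda>j. e (s j)) [0..<m], map (\<lambda>j. e (t j)) [0..<m]) \<in> Q)"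
proof -
  have "definable (\<lambda>e. map (\<lambda>l. e (if l < m then s l else t (l - m))) [0..<2 * m] \<in> def_set nat_plus (2 * m) (eq_fm \<iota>))"
    by (rule definable_in_def_set[OF fv_eq])
  then have "definable (\<lambda>e. map (\<lambda>j. e (s j)) [0..<m] @ map (\<lambda>j. e (t j)) [0..<m] \<in> def_set nat_plus (2 * m) (eq_fm \<iota>))"
    unfolding map_append_map mult_2 by (simp add: if_distrib)
  then show ?thesis unfolding ieq_def mem_Collect_eq case_prod_conv
    by (intro definable_conj definable_in_D)
qed

lemma definable_add_fm:
  "definable (\<lambda>e. map (\<lambda>j. e (s j)) [0..<m] @ map (\<lambda>j. e (t j)) [0..<m] @ map (\<lambda>j. e (u j)) [0..<m]
     \<in> def_set nat_plus (3 * m) (add_fm \<iota>))"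
proof -
  have "map (\<lambda>j. e (s j)) [0..<m] @ map (\<lambda>j. e (t j)) [0..<m] @ map (\<lambda>j. e (u j)) [0..<m] =
      map (\<lambda>l. e (if l < m then s l else if l - m < m then t (l - m) else u (l - m - m))) [0..<3 * m]" for e :: "nat \<Rightarrow> nat"
    unfolding map_append_map by (intro map_cong arg_cong2[of _ _ _ _ upt]) auto
  then show ?thesis by (simp only: definable_in_def_set[OF fv_add])
qed

text \<open>An assignment codes infinitely many numbers, at even places, and infinitely many
  \<open>m\<close>-tuples, at odd places.\<close>

definition num :: "(nat \<Rightarrow> nat) \<Rightarrow> nat \<Rightarrow> nat" where
  "num e i = e (2 * i)"

definition tup :: "(nat \<Rightarrow> nat) \<Rightarrow> nat \<Rightarrow> nat list" where
  "tup e i = map (\<lambda>j. e (2 * (i * m + j) + 1)) [0..<m]"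

text \<open>A relation involving classes is pulled back to assignments of numbers. \<open>R\<close>
  is constrained only where every coded tuple lies in the domain, because other tuples represent no
  element of the model.\<close>

definition dfb :: "((nat \<Rightarrow> nat) \<Rightarrow> (nat \<Rightarrow> nat list set) \<Rightarrow> bool) \<Rightarrow> bool" where
  "dfb P \<longleftrightarrow> (\<exists>R. definable R \<and>
     (\<forall>e. (\<forall>i. tup e i \<in> D) \<longrightarrow> R e = P (num e) (\<lambda>i. Q `` {tup e i})))"

lemma dfbI:
  "definable R \<Longrightarrow> (\<And>e. (\<And>i. tup e i \<in> D) \<Longrightarrow> R e = P (num e) (\<lambda>i. Q `` {tup e i})) \<Longrightarrow> dfb P"
  unfolding dfb_def by blast

lemma dfb_cong:
  assumes "\<And>\<nu> E. (\<And>i. E i \<in> U) \<Longrightarrow> P \<nu> E = P' \<nu> E" "dfb P"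
  shows "dfb P'"
proof -
  obtain R where R: "definable R" "\<And>e. (\<And>i. tup e i \<in> D) \<Longrightarrow> R e = P (num e) (\<lambda>i. Q `` {tup e i})"
    using assms(2) unfolding dfb_def by blast
  show ?thesis by (rule dfbI[OF R(1)]) (simp add: R(2) assms(1) class_in_U)
qed

lemma dfb_not: "dfb P \<Longrightarrow> dfb (\<lambda>\<nu> E. \<not> P \<nu> E)"
  unfolding dfb_def using definable_not by fastforce

lemma dfb_conj:
  assumes "dfb P" "dfb P'"
  shows "dfb (\<lambda>\<nu> E. P \<nu> E \<and> P' \<nu> E)"
proof -
  obtain R R' where R: "definable R" "definable R'"
    "\<And>e. (\<And>i. tup e i \<in> D) \<Longrightarrow> R e = P (num e) (\<lambda>i. Q `` {tup e i})"
    "\<And>e. (\<And>i. tup e i \<in> D) \<Longrightarrow> R' e = P' (num e) (\<lambda>i. Q `` {tup e i})"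
    using assms unfolding dfb_def by blast
  show ?thesis by (rule dfbI[OF definable_conj[OF R(1,2)]]) (simp add: R(3,4))
qed

lemma dfb_exN:
  assumes "dfb (\<lambda>\<nu> E. P (\<lambda>i. \<nu> (Suc i)) E (\<nu> 0))"
  shows "dfb (\<lambda>\<nu> E. \<exists>a. P \<nu> E a)"
proof -
  obtain R where R: "definable R"
    "\<And>e. (\<And>i. tup e i \<in> D) \<Longrightarrow> R e = P (\<lambda>i. num e (Suc i)) (\<lambda>i. Q `` {tup e i}) (num e 0)"
    using assms unfolding dfb_def by blast
  \<comment> \<open>Numbers move up by one even place and tuples stay. At \<open>k = 0\<close>
    truncated subtraction yields index 0, where \<open>case_nat a e\<close> has the new
    number.\<close>
  define \<sigma> where "\<sigma> k = (if even k then k - 1 else Suc k)" for k :: nat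
  have case_nat_self: "case_nat (e 0) (\<lambda>i. e (Suc i)) = e" for e :: "nat \<Rightarrow> nat"
    by (auto simp: fun_eq_iff split: nat.split)
  have "definable (\<lambda>e. \<exists>a. R (\<lambda>k. case_nat a e (\<sigma> k)))"
    by (rule definable_ex) (simp only: case_nat_self definable_rename[OF R(1)])
  then show ?thesis
  proof (rule dfbI)
    fix e assume e: "\<And>i. tup e i \<in> D"
    have t: "tup (\<lambda>k. case_nat a e (\<sigma> k)) i = tup e i" for a i
      unfolding tup_def by (simp add: \<sigma>_def)
    have n: "num (\<lambda>k. case_nat a e (\<sigma> k)) i = case_nat a (num e) i" for a i
      unfolding num_def by (cases i) (simp_all add: \<sigma>_def)
    show "(\<exists>a. R (\<lambda>k. case_nat a e (\<sigma> k))) = (\<exists>a. P (num e) (\<lambda>i. Q `` {tup e i}) a)"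
      using R(2) e by (simp add: t n)
  qed
qed

lemma dfb_exE:
  assumes "dfb (\<lambda>\<nu> E. P \<nu> (\<lambda>i. E (Suc i)) (E 0))"
  shows "dfb (\<lambda>\<nu> E. \<exists>X\<in>U. P \<nu> E X)"
proof -
  obtain R where R: "definable R"
    "\<And>e. (\<And>i. tup e i \<in> D) \<Longrightarrow> R e = P (num e) (\<lambda>i. Q `` {tup e (Suc i)}) (Q `` {tup e 0})"
    using assms unfolding dfb_def by blast
  \<comment> \<open>The new tuple enters at the first \<open>m\<close> odd places, so old tuples
    move by \<open>2 * m\<close> places; one \<open>m\<close> is subtracted here and the other in
    \<open>f\<close>. At even places the two shifts cancel.\<close>
  define \<sigma> where "\<sigma> k = (if even k then k + m else if k div 2 < m then k div 2 else k - m)" for k :: nat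
  define f where "f e xs i = (if i < m then xs ! i else e (i - m))" for e :: "nat \<Rightarrow> nat" and xs i
  have f_self: "f (\<lambda>i. e (i + m)) (map e [0..<m]) = e" for e
    by (auto simp: fun_eq_iff f_def)
  have "definable (\<lambda>e. \<exists>xs. length xs = m \<and> xs \<in> D \<and> R (\<lambda>k. f e xs (\<sigma> k)))"
    by (rule definable_ex_list) (simp only: f_self definable_conj definable_in_D definable_rename[OF R(1)])
  then show ?thesis
  proof (rule dfbI)
    fix e assume e: "\<And>i. tup e i \<in> D"
    have n: "num (\<lambda>k. f e xs (\<sigma> k)) = num e" for xs
      unfolding num_def by (simp add: \<sigma>_def f_def fun_eq_iff)
    have t0: "tup (\<lambda>k. f e xs (\<sigma> k)) 0 = xs" if "length xs = m" for xs
      unfolding tup_def using that by (intro nth_equalityI) (simp_all add: \<sigma>_def f_def)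
    have tS: "tup (\<lambda>k. f e xs (\<sigma> k)) (Suc i) = tup e i" for xs i
    proof -
      have "2 * (Suc i * m + j) + 1 - m - m = 2 * (i * m + j) + 1" for j
        by (simp add: algebra_simps)
      then show ?thesis unfolding tup_def by (simp add: \<sigma>_def f_def)
    qed
    have "R (\<lambda>k. f e xs (\<sigma> k)) = P (num e) (\<lambda>i. Q `` {tup e i}) (Q `` {xs})" if "xs \<in> D" for xs
    proof -
      have "tup (\<lambda>k. f e xs (\<sigma> k)) i \<in> D" for i
        using that e t0[OF length_D[OF that]] tS by (cases i) simp_all
      then show ?thesis using R(2) t0[OF length_D[OF that]] by (simp add: n tS)
    qed
    then show "(\<exists>xs. length xs = m \<and> xs \<in> D \<and> R (\<lambda>k. f e xs (\<sigma> k))) =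
        (\<exists>X\<in>U. P (num e) (\<lambda>i. Q `` {tup e i}) X)"
      unfolding ex_U using length_D by blast
  qed
qed

text \<open>The relation \<open>iadd\<close> asks for some representatives of the three classes;
  they are quantified as tuples equivalent to the coded ones.\<close>

lemma dfb_addE: "dfb (\<lambda>\<nu> E. add (E i) (E j) = E k)"
proof (rule dfbI)
  show "definable (\<lambda>e. \<exists>x. length x = m \<and> (tup e i, x) \<in> Q \<and> (\<exists>y. length y = m \<and> (tup e j, y) \<in> Q \<and>
      (\<exists>z. length z = m \<and> (tup e k, z) \<in> Q \<and> x @ y @ z \<in> def_set nat_plus (3 * m) (add_fm \<iota>))))"
    unfolding tup_def by (intro definable_ex_list definable_conj definable_in_Q definable_add_fm)
next
  fix e assume e: "\<And>i. tup e i \<in> D"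
  have "length x = m" if "(y, x) \<in> Q" for x y using that length_D unfolding ieq_def by blast
  then show "(\<exists>x. length x = m \<and> (tup e i, x) \<in> Q \<and> (\<exists>y. length y = m \<and> (tup e j, y) \<in> Q \<and>
      (\<exists>z. length z = m \<and> (tup e k, z) \<in> Q \<and> x @ y @ z \<in> def_set nat_plus (3 * m) (add_fm \<iota>)))) =
    (add (Q `` {tup e i}) (Q `` {tup e j}) = Q `` {tup e k})"
    unfolding add_iff[OF class_in_U[OF e] class_in_U[OF e] class_in_U[OF e]] iadd_def by blast
qed

lemma dfb_eqE: "dfb (\<lambda>\<nu> E. E i = E j)"
proof (rule dfbI)
  show "definable (\<lambda>e. (tup e i, tup e j) \<in> Q)" unfolding tup_def by (rule definable_in_Q)
qed (use equiv eq_equiv_class_iff in metis)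

lemma dfb_rk: "dfb (\<lambda>\<nu> E. rk (E i) \<le> \<nu> j)"
proof (rule dfbI)
  have "definable (\<lambda>e. \<forall>l<m. map (\<lambda>j. e (s j)) [0..<m] ! l \<le> e n)" for s n
    by (rule definable_All_less) (simp add: definable_le)
  then show "definable (\<lambda>e. \<exists>x. length x = m \<and> (tup e i, x) \<in> Q \<and> (\<forall>l<m. x ! l \<le> num e j))"
    unfolding tup_def num_def by (intro definable_ex_list definable_conj definable_in_Q)
next
  fix e assume e: "\<And>i. tup e i \<in> D"
  have "length x = m" if "(y, x) \<in> Q" for x y using that length_D unfolding ieq_def by blast
  then show "(\<exists>x. length x = m \<and> (tup e i, x) \<in> Q \<and> (\<forall>l<m. x ! l \<le> num e j)) = (rk (Q `` {tup e i}) \<le> num e j)"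
    unfolding rk_le_iff[OF class_in_U[OF e]] by (auto simp: all_set_conv_all_nth)
qed

lemma dfb_periodic:
  assumes "dfb (\<lambda>\<nu> E. \<nu> 0 \<in> S)"
  shows "eventually_periodic S"
proof -
  obtain R where R: "definable R" "\<And>e. (\<And>i. tup e i \<in> D) \<Longrightarrow> R e \<longleftrightarrow> num e 0 \<in> S"
    using assms unfolding dfb_def by blast
  obtain x where x: "x \<in> D" using D_nonempty by blast
  \<comment> \<open>All coded tuples equal \<open>x\<close>, so they stay in the domain when the
    number at place 0 varies.\<close>
  define e where "e k = x ! ((k div 2) mod m)" for k :: nat
  have "tup (e(0 := n)) i = x" for n i
    unfolding tup_def using length_D[OF x] by (intro nth_equalityI) (simp_all add: e_def)
  then have "R (e(0 := n)) \<longleftrightarrow> n \<in> S" for n using R(2) x by (simp add: num_def)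
  then show ?thesis using definable_eventually_periodic[OF R(1), of e] by simp
qed

lemma defining_formula:
  assumes "dfb (\<lambda>\<nu> E. \<nu> 0 = h (E 0))"
  shows "\<exists>F. defines_map nat_plus \<iota> F h"
proof -
  obtain R where R: "definable R" "\<And>e. (\<And>i. tup e i \<in> D) \<Longrightarrow> R e \<longleftrightarrow> num e 0 = h (Q `` {tup e 0})"
    using assms unfolding dfb_def by blast
  \<comment> \<open>The infinitely many coded objects collapse to a single tuple at the positions
    below \<open>m\<close> and a single number at position \<open>m\<close>. Then all coded tuples
    are in the domain as soon as this one is, and only positions up to \<open>m\<close>
    matter.\<close>
  define \<sigma> where "\<sigma> k = (if even k then m else (k div 2) mod m)" for k :: nat
  let ?P = "\<lambda>e. map (\<lambda>j. e j) [0..<m] \<in> D \<and> R (\<lambda>k. e (\<sigma> k))"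
  have P: "?P e \<longleftrightarrow> map e [0..<m] \<in> D \<and> e m = h (Q `` {map e [0..<m]})" for e
  proof -
    have "tup (\<lambda>k. e (\<sigma> k)) i = map e [0..<m]" for i unfolding tup_def by (simp add: \<sigma>_def)
    moreover have "num (\<lambda>k. e (\<sigma> k)) 0 = e m" by (simp add: num_def \<sigma>_def)
    ultimately show ?thesis using R(2)[of "\<lambda>k. e (\<sigma> k)"] by auto
  qed
  have dep: "?P e = ?P e'" if "\<And>i. i \<in> {..m} \<Longrightarrow> e i = e' i" for e e'
  proof -
    have "map e [0..<m] = map e' [0..<m]" "e m = e' m" using that by auto
    then show ?thesis unfolding P by (simp only:)
  qed
  have "\<exists>F. fv F \<subseteq> {..m} \<and> (\<forall>e. sat nat_plus e F = ?P e)"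
    by (rule definable_closed_form[OF definable_conj[OF definable_in_D definable_rename[OF R(1)]] dep])
  then obtain F where F: "fv F \<subseteq> {..m}" "\<And>e. sat nat_plus e F = ?P e" by blast
  have "def_set nat_plus (m + 1) F = {x @ [h (Q `` {x})] | x. x \<in> D}"
  proof (intro equalityI subsetI)
    fix xs assume "xs \<in> def_set nat_plus (m + 1) F"
    then have xs: "length xs = m + 1" "sat nat_plus (\<lambda>i. xs ! i) F" unfolding def_set_def by auto
    have "map (\<lambda>i. xs ! i) [0..<m] = butlast xs" using xs(1) by (intro nth_equalityI) (auto simp: nth_butlast)
    then have "butlast xs \<in> D" "xs ! m = h (Q `` {butlast xs})" using xs(2) unfolding F(2) P by auto
    moreover have "xs = butlast xs @ [xs ! m]"
      using xs(1) by (metis Suc_eq_plus1 append_butlast_last_id diff_Suc_1 last_conv_nth length_0_conv nat.distinct(1))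
    ultimately show "xs \<in> {x @ [h (Q `` {x})] | x. x \<in> D}" by auto
  next
    fix xs assume "xs \<in> {x @ [h (Q `` {x})] | x. x \<in> D}"
    then obtain x where x: "x \<in> D" "xs = x @ [h (Q `` {x})]" by blast
    have map: "map (\<lambda>i. xs ! i) [0..<m] = x"
      using x length_D[OF x(1)] by (intro nth_equalityI) (auto simp: nth_append)
    have "xs ! m = h (Q `` {x})" "length xs = m + 1"
      using x(2) length_D[OF x(1)] by (auto simp: nth_append)
    moreover from this have "sat nat_plus (\<lambda>i. xs ! i) F"
      using P[of "\<lambda>i. xs ! i"] x(1) unfolding F(2) map by blast
    moreover have "universe nat_plus = UNIV" by (simp add: nat_plus_def)
    ultimately show "xs \<in> def_set nat_plus (m + 1) F" by (simp add: def_set_def)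
  qed
  then show ?thesis using F(1) unfolding defines_map_def by blast
qed

end

section \<open>First-order consequences of Presburger Arithmetic\<close>

lemma model_of_PrA_sat:
  assumes "model_of M PrA" "fv \<phi> = {}" "\<And>e. sat nat_plus e \<phi>"
  shows "sat M e \<phi>"
proof -
  obtain a where "a \<in> universe M" using assms(1) unfolding model_of_def fo_struct_def by blast
  moreover have "\<phi> \<in> PrA" using assms(2,3) unfolding PrA_def true_in_def by blast
  ultimately have "sat M (\<lambda>_. a) \<phi>" using assms(1) unfolding model_of_def true_in_def by simp
  then show ?thesis using sat_cong[of \<phi> "\<lambda>_. a" e M] assms(2) by simp
qed

definition Forall :: "nat \<Rightarrow> fm \<Rightarrow> fm" where "Forall i \<phi> = Neg (Ex i (Neg \<phi>))"

definition Disj :: "fm \<Rightarrow> fm \<Rightarrow> fm" where "Disj \<phi> \<psi> = Neg (Conj (Neg \<phi>) (Neg \<psi>))"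

lemma sat_Forall [simp]: "sat M e (Forall i \<phi>) \<longleftrightarrow> (\<forall>a\<in>universe M. sat M (e(i := a)) \<phi>)"
  and sat_Disj [simp]: "sat M e (Disj \<phi> \<psi>) \<longleftrightarrow> sat M e \<phi> \<or> sat M e \<psi>"
  and fv_Forall [simp]: "fv (Forall i \<phi>) = fv \<phi> - {i}"
  and fv_Disj [simp]: "fv (Disj \<phi> \<psi>) = fv \<phi> \<union> fv \<psi>"
  by (auto simp: Forall_def Disj_def)

text \<open>Apart from closure, each item is transferred by a sentence true in (\<nat>, +). The
  constants 0 and 1 are not in the language, so a single sentence asserts their existence together
  with all properties that mention them.\<close>

lemma model_of_PrA_axioms:
  assumes "model_of M PrA"
  defines "U \<equiv> universe M" and "p \<equiv> addition M"
  shows "x \<in> U \<Longrightarrow> y \<in> U \<Longrightarrow> p x y \<in> U"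
    and "x \<in> U \<Longrightarrow> y \<in> U \<Longrightarrow> z \<in> U \<Longrightarrow> p (p x y) z = p x (p y z)"
    and "x \<in> U \<Longrightarrow> y \<in> U \<Longrightarrow> p x y = p y x"
    and "x \<in> U \<Longrightarrow> y \<in> U \<Longrightarrow> z \<in> U \<Longrightarrow> p x y = p x z \<Longrightarrow> y = z"
    and "x \<in> U \<Longrightarrow> y \<in> U \<Longrightarrow> \<exists>z\<in>U. p x z = y \<or> p y z = x"
    and "\<exists>o1\<in>U. \<exists>o0\<in>U. o1 \<noteq> o0 \<and> (\<forall>x\<in>U. p x o0 = x) \<and>
      (\<forall>x\<in>U. \<forall>y\<in>U. p x y = o0 \<longrightarrow> x = o0) \<and> (\<forall>x\<in>U. x = o0 \<or> (\<exists>y\<in>U. x = p y o1)) \<and>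
      (\<forall>x\<in>U. \<exists>y\<in>U. x = p y y \<or> x = p (p y y) o1)"
proof -
  note T = model_of_PrA_sat[OF assms(1)]
  show "x \<in> U \<Longrightarrow> y \<in> U \<Longrightarrow> p x y \<in> U"
    using assms(1) unfolding U_def p_def model_of_def fo_struct_def by blast
  have "sat M e (Forall 0 (Forall 1 (Forall 2 (Eq (Plus (Plus (Var 0) (Var 1)) (Var 2)) (Plus (Var 0) (Plus (Var 1) (Var 2)))))))" for e
    by (rule T) (auto simp: nat_plus_def)
  then show "x \<in> U \<Longrightarrow> y \<in> U \<Longrightarrow> z \<in> U \<Longrightarrow> p (p x y) z = p x (p y z)"
    by (simp add: U_def p_def)
  have "sat M e (Forall 0 (Forall 1 (Eq (Plus (Var 0) (Var 1)) (Plus (Var 1) (Var 0)))))" for e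
    by (rule T) (auto simp: nat_plus_def)
  then show "x \<in> U \<Longrightarrow> y \<in> U \<Longrightarrow> p x y = p y x"
    by (simp add: U_def p_def)
  have "sat M e (Forall 0 (Forall 1 (Forall 2 (Disj (Neg (Eq (Plus (Var 0) (Var 1)) (Plus (Var 0) (Var 2)))) (Eq (Var 1) (Var 2))))))" for e
    by (rule T) (auto simp: nat_plus_def)
  then show "x \<in> U \<Longrightarrow> y \<in> U \<Longrightarrow> z \<in> U \<Longrightarrow> p x y = p x z \<Longrightarrow> y = z"
    by (simp add: U_def p_def)
  have "sat M e (Forall 0 (Forall 1 (Ex 2 (Disj (Eq (Plus (Var 0) (Var 2)) (Var 1)) (Eq (Plus (Var 1) (Var 2)) (Var 0))))))" for e
    by (rule T) (auto simp: nat_plus_def, presburger)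
  then show "x \<in> U \<Longrightarrow> y \<in> U \<Longrightarrow> \<exists>z\<in>U. p x z = y \<or> p y z = x"
    by (simp add: U_def p_def)
  have arith: "\<exists>o1 o0. o1 \<noteq> o0 \<and> (\<forall>x. x + o0 = x) \<and> (\<forall>x y. x + y \<noteq> o0 \<or> x = o0) \<and>
    (\<forall>x. x = o0 \<or> (\<exists>y. x = y + o1)) \<and> (\<forall>x. \<exists>y. x = y + y \<or> x = y + y + (o1 :: nat))"
    by (rule exI[of _ 1], rule exI[of _ 0]) presburger
  have "sat M e (Ex 0 (Ex 1 (Conj (Neg (Eq (Var 0) (Var 1))) (Conj (Forall 2 (Eq (Plus (Var 2) (Var 1)) (Var 2)))
    (Conj (Forall 2 (Forall 3 (Disj (Neg (Eq (Plus (Var 2) (Var 3)) (Var 1))) (Eq (Var 2) (Var 1)))))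
    (Conj (Forall 2 (Disj (Eq (Var 2) (Var 1)) (Ex 3 (Eq (Var 2) (Plus (Var 3) (Var 0))))))
      (Forall 2 (Ex 3 (Disj (Eq (Var 2) (Plus (Var 3) (Var 3))) (Eq (Var 2) (Plus (Plus (Var 3) (Var 3)) (Var 0))))))))))))" for e
    by (rule T) (use arith in \<open>simp_all add: nat_plus_def insert_commute insert_Diff_if\<close>)
  then show "\<exists>o1\<in>U. \<exists>o0\<in>U. o1 \<noteq> o0 \<and> (\<forall>x\<in>U. p x o0 = x) \<and>
      (\<forall>x\<in>U. \<forall>y\<in>U. p x y = o0 \<longrightarrow> x = o0) \<and> (\<forall>x\<in>U. x = o0 \<or> (\<exists>y\<in>U. x = p y o1)) \<and>
      (\<forall>x\<in>U. \<exists>y\<in>U. x = p y y \<or> x = p (p y y) o1)"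
    by (simp add: U_def p_def)
qed

theorem theorem1p2:
  fixes \<iota> :: interp and \<AA> :: "nat list set struct"
  assumes "interpretation_in nat_plus \<iota>"
    and "\<AA> = internal_model nat_plus \<iota>"
    and "model_of \<AA> PrA"
  shows "isomorphic \<AA> nat_plus \<and>
    (\<exists>F h. isomorphism \<AA> nat_plus h \<and> defines_map nat_plus \<iota> F h)"
proof -
  interpret I: nat_interpretation \<iota> by standard (rule assms(1))
  have model: "model_of (internal_model nat_plus \<iota>) PrA" using assms(2,3) by simp
  have univ: "universe (internal_model nat_plus \<iota>) = I.U" by (simp add: internal_model_def)
  note ax = model_of_PrA_axioms[OF model, unfolded univ]
  obtain o1 o0 where o: "o1 \<in> I.U" "o0 \<in> I.U" "o1 \<noteq> o0" "\<forall>x\<in>I.U. I.add x o0 = x"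
    "\<forall>x\<in>I.U. \<forall>y\<in>I.U. I.add x y = o0 \<longrightarrow> x = o0" "\<forall>x\<in>I.U. x = o0 \<or> (\<exists>y\<in>I.U. x = I.add y o1)"
    "\<forall>x\<in>I.U. \<exists>y\<in>I.U. x = I.add y y \<or> x = I.add (I.add y y) o1"
    using ax(6) by (elim bexE conjE)
  \<comment> \<open>The elements \<open>o0\<close> and \<open>o1\<close> serve as zero and one, and
    the dimension of the interpretation is the exponent in the bound on balls.\<close>
  interpret P: presburger_like I.U I.add o0 o1 I.rk I.m I.dfb
  proof
    show "I.dfb Q" if "\<And>\<nu> E. (\<And>i. E i \<in> I.U) \<Longrightarrow> P \<nu> E = Q \<nu> E" "I.dfb P" for P Q
      using that by (rule I.dfb_cong)
    show "I.dfb (\<lambda>\<nu> E. \<not> P \<nu> E)" if "I.dfb P" for P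
      using that by (rule I.dfb_not)
    show "I.dfb (\<lambda>\<nu> E. P \<nu> E \<and> Q \<nu> E)" if "I.dfb P" "I.dfb Q" for P Q
      using that by (rule I.dfb_conj)
    show "I.dfb (\<lambda>\<nu> E. \<nu> i + \<nu> j = \<nu> k)" for i j k
      by (rule I.dfbI[OF definable_add]) (simp add: I.num_def)
    show "I.dfb (\<lambda>\<nu> E. \<nu> i = c)" for i c
      by (rule I.dfbI[OF definable_const]) (simp add: I.num_def)
    show "o0 \<in> I.U" "o1 \<in> I.U" "o1 \<noteq> o0" by (fact o)+
    show "I.add x o0 = x" if "x \<in> I.U" for x using o(4) that by blast
    show "x = o0" if "x \<in> I.U" "y \<in> I.U" "I.add x y = o0" for x y using o(5) that by blast
    show "\<exists>y\<in>I.U. x = I.add y o1" if "x \<in> I.U" "x \<noteq> o0" for x using o(6) that by blast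
    show "\<exists>y\<in>I.U. x = I.add y y \<or> x = I.add (I.add y y) o1" if "x \<in> I.U" for x using o(7) that by blast
  qed (rule ax(1-5) I.finite_ball I.card_ball I.dfb_exN I.dfb_exE I.dfb_addE I.dfb_eqE I.dfb_rk I.dfb_periodic; assumption)+
  have "isomorphism \<AA> nat_plus P.h"
    unfolding isomorphism_def assms(2) univ using P.bij_h P.h_add by (simp add: nat_plus_def)
  moreover obtain F where "defines_map nat_plus \<iota> F P.h"
    using I.defining_formula[OF P.graph_definable] by blast
  ultimately show ?thesis unfolding isomorphic_def by blast
qed

end
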